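(* Let $p$ be a prime and $n=p^3$. If $R$ is a type-$p$ most-perfect square of order $n$, then $\theta(R)$ is an order-$n$ pandiagonal Franklin square of type $p$ (pandiagonal meaning every broken diagonal in either direction sums to $\frac{n(n^2-1)}{2}$). Further, type-$p$ most-perfect squares of order $p^3$ exist for every prime $p$.
   Context: Rows and columns of an $n\times n$ array are indexed $0,\dots,n-1$, indices read modulo $n$ where wraparound is allowed. A natural square of order $n$ is an $n\times n$ array containing each of $0,\dots,n^2-1$ exactly once; its magic sum is $\frac{n(n^2-1)}{2}$. A natural square is pandiagonal magic if every row, column and broken diagonal (either direction) sums to the magic sum. The $p\times p$ property: every $p\times p$ subsquare of consecutive rows and columns (toric wraparound allowed) sums to $\frac{p^2(n^2-1)}{2}$. For $p\mid n$, a type-$p$ most-perfect square of order $n$ is a natural pandiagonal magic square with the $p\times p$ property and the complementary property: for every position $(r,c)$ the entries at $(r+t\frac np,c+t\frac np)$ (mod $n$), $t=0,\dots,p-1$, sum to $\frac{p(n^2-1)}{2}$. The $1/p$ column property: splitting each column into the $p$ parts of rows $s\frac np,\dots,(s+1)\frac np-1$ ($0\le s\le p-1$), each part sums to $\frac{n(n^2-1)}{2p}$; the $1/p$ row property is analogous. The map $\theta$: view an $n\times n$ array $R$ ($p^2\mid n$) as a $p^2\times p^2$ block array $(R_{i,j})$ of $\frac{n}{p^2}\times\frac{n}{p^2}$ blocks; for $i=\ell p+m$ ($0\le \ell,m\le p-1$) let $\bar i=mp+\ell$; then $[\theta(R)]_{i,j}=R_{\bar i,\bar j}$. Franklin patterns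 (for $n=p^3$). Fix $r_0\in\{0,\dots,n-1\}$ and integers $\alpha,\beta\ge1$ with $\alpha+\beta=p$. For $0\le i\le p-1$, $0\le j\le p^2-1$ let the block $T_{i,j}$ be the set of cells $(r_0+ip+a,\ jp+b)$, $0\le a,b\le p-1$ (row index mod $n$); "row $a$ of $T_{i,j}$" means the cells with that $a$, "the first $\alpha$ entries" of it means those with $b<\alpha$ and "the last $\beta$ entries" those with $b\ge\alpha$. The Franklin-up pattern $W=W(r_0,\alpha,\beta)$ is the set of cells consisting of: (1) for each integer $j$ with $0\le j<\frac{p-1}{2}$ and each $0\le i\le p-1$: if $j$ is even, the first $\alpha$ entries of row $2j$ and the last $\beta$ entries of row $2j+1$ of $T_{i,jp+i}$, together with the last $\beta$ entries of row $2j$ and the first $\alpha$ entries of row $2j+1$ of $T_{i,(p-1-j)p+(p-1-i)}$; if $j$ is odd, the last $\beta$ entries of row $2j$ and the first $\alpha$ entries of row $2j+1$ of $T_{i,jp+(p-1-i)}$, together with the first $\alpha$ entries of row $2j$ and the last $\beta$ entries of row $2j+1$ of $T_{i,(p-1-j)p+i}$; (2) if $p$ is odd, with $c=\frac{p-1}{2}$, cells in the bottom row (row $p-1$) of blocks in block-columns $cp,\dots,cp+p-1$ as follows. If $c$ is odd: the whole bottom row of $T_{0,cp+c}$, and for $1\le i\le p-1$ the blocks $L_i=T_{i,cp+c-\lceil i/2\rceil}$, $R_i=T_{i,cp+c+\lceil i/2\rceil}$. If $c$ is even: the whole bottom row of $T_{p-1,cp+c}$, and for $0\le i\le p-2$ the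 blocks $L_i=T_{i,cp+\lfloor i/2\rfloor}$, $R_i=T_{i,cp+p-1-\lfloor i/2\rfloor}$. For these $i$, $W$ contains, when $i$ is even, the first $\alpha$ entries of the bottom row of $L_i$ and the last $\beta$ entries of the bottom row of $R_i$; when $i$ is odd, the last $\beta$ entries of the bottom row of $L_i$ and the first $\alpha$ entries of the bottom row of $R_i$. Let $\rho$ be the clockwise quarter-turn of positions, $\rho(r,c)=(c,n-1-r)$. The Franklin patterns of an $n\times n$ square are the sets $W(r_0,\alpha,\beta)$ (Franklin-up) and their images under $\rho,\rho^2,\rho^3$ (Franklin-right, -down, -left), for all $r_0$ and all $\alpha,\beta\ge 1$ with $\alpha+\beta=p$. A Franklin square of type $p$ of order $n=p^3$ is a natural square of order $n$ having the $p\times p$ property, the $1/p$ row and column properties, and such that the entries in every Franklin pattern sum to $\frac{n(n^2-1)}{2}$. *)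

theory Defs
  imports Complex_Main "HOL-Computational_Algebra.Primes"
begin

text \<open>An \<open>n \<times> n\<close> array is a function \<open>R :: nat \<Rightarrow> nat \<Rightarrow> nat\<close> of which only the values
  \<open>R r c\<close> with \<open>r, c < n\<close> matter. All required sums are stated in the reals, so that the
  fractions in the magic constants are exact.\<close>

type_synonym square = "nat \<Rightarrow> nat \<Rightarrow> nat"

definition natural_square :: "nat \<Rightarrow> square \<Rightarrow> bool" where
  "natural_square n R \<longleftrightarrow>
     bij_betw (\<lambda>(r, c). R r c) ({..<n} \<times> {..<n}) {..<n\<^sup>2}"

definition magic_sum :: "nat \<Rightarrow> real" where
  "magic_sum n = real n * ((real n)\<^sup>2 - 1) / 2"

text \<open>In the second conjunct, \<open>d + n - i\<close> represents \<open>d - i\<close> modulo \<open>n\<close> without truncation.\<close>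

definition broken_diagonals_magic :: "nat \<Rightarrow> square \<Rightarrow> bool" where
  "broken_diagonals_magic n R \<longleftrightarrow>
     (\<forall>d<n. real (\<Sum>i<n. R i ((d + i) mod n)) = magic_sum n) \<and>
     (\<forall>d<n. real (\<Sum>i<n. R i ((d + n - i) mod n)) = magic_sum n)"

definition pandiagonal_magic :: "nat \<Rightarrow> square \<Rightarrow> bool" where
  "pandiagonal_magic n R \<longleftrightarrow>
     (\<forall>r<n. real (\<Sum>c<n. R r c) = magic_sum n) \<and>
     (\<forall>c<n. real (\<Sum>r<n. R r c) = magic_sum n) \<and>
     broken_diagonals_magic n R"

definition subsquare_property :: "nat \<Rightarrow> nat \<Rightarrow> square \<Rightarrow> bool" where
  "subsquare_property p n R \<longleftrightarrow>
     (\<forall>r<n. \<forall>c<n. real (\<Sum>a<p. \<Sum>b<p. R ((r + a) mod n) ((c + b) mod n))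
        = (real p)\<^sup>2 * ((real n)\<^sup>2 - 1) / 2)"

definition complementary_property :: "nat \<Rightarrow> nat \<Rightarrow> square \<Rightarrow> bool" where
  "complementary_property p n R \<longleftrightarrow>
     (\<forall>r<n. \<forall>c<n.
        real (\<Sum>t<p. R ((r + t * (n div p)) mod n) ((c + t * (n div p)) mod n))
          = real p * ((real n)\<^sup>2 - 1) / 2)"

definition most_perfect :: "nat \<Rightarrow> nat \<Rightarrow> square \<Rightarrow> bool" where
  "most_perfect p n R \<longleftrightarrow>
     p dvd n \<and> natural_square n R \<and> pandiagonal_magic n R \<and>
     subsquare_property p n R \<and> complementary_property p n R"

definition column_part_property :: "nat \<Rightarrow> nat \<Rightarrow> square \<Rightarrow> bool" where
  "column_part_property p n R \<longleftrightarrow>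
     (\<forall>c<n. \<forall>s<p. real (\<Sum>r = s * (n div p)..<(s + 1) * (n div p). R r c)
        = real n * ((real n)\<^sup>2 - 1) / (2 * real p))"

definition row_part_property :: "nat \<Rightarrow> nat \<Rightarrow> square \<Rightarrow> bool" where
  "row_part_property p n R \<longleftrightarrow>
     (\<forall>r<n. \<forall>s<p. real (\<Sum>c = s * (n div p)..<(s + 1) * (n div p). R r c)
        = real n * ((real n)\<^sup>2 - 1) / (2 * real p))"

text \<open>For \<open>i = l * p + m\<close> with \<open>l, m < p\<close> this is \<open>m * p + l\<close>.\<close>

definition digit_swap :: "nat \<Rightarrow> nat \<Rightarrow> nat" where
  "digit_swap p i = (i mod p) * p + i div p"

text \<open>With \<open>q = n div p\<^sup>2\<close>, position \<open>(r, c)\<close> is cell \<open>(r mod q, c mod q)\<close> of the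
  \<open>q \<times> q\<close> block \<open>(r div q, c div q)\<close>.\<close>

definition theta :: "nat \<Rightarrow> nat \<Rightarrow> square \<Rightarrow> square" where
  "theta p n R = (\<lambda>r c. let q = n div p\<^sup>2 in
     R (digit_swap p (r div q) * q + r mod q) (digit_swap p (c div q) * q + c mod q))"

text \<open>\<open>cells p r\<^sub>0 i j a B\<close> are the entries in positions \<open>b \<in> B\<close> of row \<open>a\<close> of the block
  \<open>T\<^bsub>i,j\<^esub>\<close>. In the patterns below, \<open>F = {..<\<alpha>}\<close> selects the first \<open>\<alpha>\<close> entries and
  \<open>L = {\<alpha>..<\<alpha> + \<beta>}\<close> the last \<open>\<beta>\<close> entries, as \<open>\<alpha> + \<beta> = p\<close>.\<close>

definition cells :: "nat \<Rightarrow> nat \<Rightarrow> nat \<Rightarrow> nat \<Rightarrow> nat \<Rightarrow> nat set \<Rightarrow> (nat \<times> nat) set" where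
  "cells p r\<^sub>0 i j a B = (\<lambda>b. ((r\<^sub>0 + i * p + a) mod p ^ 3, j * p + b)) ` B"

definition franklin_sides :: "nat \<Rightarrow> nat \<Rightarrow> nat \<Rightarrow> nat \<Rightarrow> (nat \<times> nat) set" where
  "franklin_sides p r\<^sub>0 \<alpha> \<beta> = (let F = {..<\<alpha>}; L = {\<alpha>..<\<alpha> + \<beta>} in
     \<Union>j\<in>{j. 2 * j < p - 1}. \<Union>i\<in>{..<p}.
       if even j then
         cells p r\<^sub>0 i (j * p + i) (2 * j) F \<union>
         cells p r\<^sub>0 i (j * p + i) (2 * j + 1) L \<union>
         cells p r\<^sub>0 i ((p - 1 - j) * p + (p - 1 - i)) (2 * j) L \<union>
         cells p r\<^sub>0 i ((p - 1 - j) * p + (p - 1 - i)) (2 * j + 1) F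
       else
         cells p r\<^sub>0 i (j * p + (p - 1 - i)) (2 * j) L \<union>
         cells p r\<^sub>0 i (j * p + (p - 1 - i)) (2 * j + 1) F \<union>
         cells p r\<^sub>0 i ((p - 1 - j) * p + i) (2 * j) F \<union>
         cells p r\<^sub>0 i ((p - 1 - j) * p + i) (2 * j + 1) L)"

text \<open>The bottom-row cells in the middle block-columns, used for odd \<open>p\<close>. On naturals,
  \<open>(i + 1) div 2\<close> is the ceiling and \<open>i div 2\<close> the floor of \<open>i / 2\<close>.\<close>

definition franklin_middle :: "nat \<Rightarrow> nat \<Rightarrow> nat \<Rightarrow> nat \<Rightarrow> (nat \<times> nat) set" where
  "franklin_middle p r\<^sub>0 \<alpha> \<beta> =
     (let F = {..<\<alpha>}; L = {\<alpha>..<\<alpha> + \<beta>}; c = (p - 1) div 2;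
          arms = (\<lambda>i jL jR.
            if even i then cells p r\<^sub>0 i jL (p - 1) F \<union> cells p r\<^sub>0 i jR (p - 1) L
            else cells p r\<^sub>0 i jL (p - 1) L \<union> cells p r\<^sub>0 i jR (p - 1) F)
      in if odd c then
           cells p r\<^sub>0 0 (c * p + c) (p - 1) {..<p} \<union>
           (\<Union>i\<in>{1..p - 1}. arms i (c * p + c - (i + 1) div 2) (c * p + c + (i + 1) div 2))
         else
           cells p r\<^sub>0 (p - 1) (c * p + c) (p - 1) {..<p} \<union>
           (\<Union>i\<in>{..<p - 1}. arms i (c * p + i div 2) (c * p + (p - 1) - i div 2)))"

definition franklin_up :: "nat \<Rightarrow> nat \<Rightarrow> nat \<Rightarrow> nat \<Rightarrow> (nat \<times> nat) set" where
  "franklin_up p r\<^sub>0 \<alpha> \<beta> =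
     franklin_sides p r\<^sub>0 \<alpha> \<beta> \<union> (if odd p then franklin_middle p r\<^sub>0 \<alpha> \<beta> else {})"

definition quarter_turn :: "nat \<Rightarrow> nat \<times> nat \<Rightarrow> nat \<times> nat" where
  "quarter_turn n = (\<lambda>(r, c). (c, n - 1 - r))"

definition franklin_patterns :: "nat \<Rightarrow> (nat \<times> nat) set set" where
  "franklin_patterns p =
     {(quarter_turn (p ^ 3) ^^ k) ` franklin_up p r\<^sub>0 \<alpha> \<beta> | k r\<^sub>0 \<alpha> \<beta>.
        k < 4 \<and> r\<^sub>0 < p ^ 3 \<and> \<alpha> \<ge> 1 \<and> \<beta> \<ge> 1 \<and> \<alpha> + \<beta> = p}"

text \<open>A Franklin square of type \<open>p\<close> always has order \<open>p ^ 3\<close>.\<close>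

definition franklin_square :: "nat \<Rightarrow> square \<Rightarrow> bool" where
  "franklin_square p R \<longleftrightarrow>
     (let n = p ^ 3 in
       natural_square n R \<and> subsquare_property p n R \<and>
       row_part_property p n R \<and> column_part_property p n R \<and>
       (\<forall>P\<in>franklin_patterns p. real (\<Sum>(r, c)\<in>P. R r c) = magic_sum n))"

end

theory Submission
  imports Defs "HOL-Number_Theory.Cong"
begin

text \<open>Subtract the mean \<open>(n\<^sup>2 - 1) / 2\<close> from all entries. For a type-\<open>p\<close> most-perfect square,
  differences of overlapping \<open>p \<times> p\<close> subsquares show that the result has the form
  \<open>A r (c mod p) + B (r mod p) c\<close>, where \<open>\<Sum>\<^sub>b A r b\<close> depends only on \<open>r mod p\<close> and
  \<open>\<Sum>\<^sub>a B a c\<close> only on \<open>c mod p\<close>. By the complementary property, summing \<open>A\<close> over the rows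
  \<open>r + t p\<^sup>2\<close> gives a value \<open>K (r mod p) b\<close>, and summing \<open>B\<close> over the columns
  \<open>c + t p\<^sup>2\<close> gives \<open>- K a (c mod p)\<close>. Since \<open>\<theta>\<close> exchanges the two leading base-\<open>p\<close>
  digits of an index, in \<open>\<theta>(R)\<close> these become sums over \<open>p\<close> consecutive blocks of length \<open>p\<close>.
  For fixed \<open>a\<close>, the rows \<open>a\<close> of the blocks of a Franklin pattern meet each
  column residue \<open>b\<close> once per block-row and in each of \<open>p\<close> consecutive block-columns, so that
  their deviations cancel. The structure is invariant under quarter turns, which
  covers the remaining patterns.\<close>

subsection \<open>Sums over residues and digits\<close>

lemma sum_digits:
  fixes h :: "nat \<Rightarrow> 'a::comm_monoid_add"
  shows "(\<Sum>i<A * B. h i) = (\<Sum>i<A. \<Sum>j<B. h (i * B + j))"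
proof -
  have "sum h {i * B..<i * B + B} = (\<Sum>j<B. h (i * B + j))" for i
    using sum.shift_bounds_nat_ivl[of h 0 "i * B" B] by (simp add: atLeast0LessThan add.commute)
  then show ?thesis
    by (simp add: sum.nat_group[of h B A, symmetric])
qed

lemma sum_shift_mod:
  fixes g :: "nat \<Rightarrow> 'a::comm_monoid_add"
  assumes "0 < p"
  shows "(\<Sum>b<p. g ((c + b) mod p)) = (\<Sum>b<p. g b)"
proof -
  \<comment> \<open>\<open>q\<close> represents the additive inverse of \<open>c\<close> modulo
    \<open>p\<close>, so shifting by \<open>q\<close> undoes shifting by \<open>c\<close>.\<close>
  obtain q where q: "c mod p + q = p"
    using assms by (metis mod_less_divisor less_imp_add_positive)
  have shift: "(c + (b + q)) mod p = b mod p" for b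
  proof -
    have "(c + (b + q)) mod p = (c mod p + (b + q)) mod p" by (simp add: mod_add_left_eq)
    also have "c mod p + (b + q) = b + p" using q by simp
    finally show ?thesis by simp
  qed
  show ?thesis
  proof (rule sum.reindex_bij_witness[of _ "\<lambda>b. (b + q) mod p" "\<lambda>b. (c + b) mod p"])
    fix b assume b: "b \<in> {..<p}"
    show "((c + b) mod p + q) mod p = b"
      using b shift[of b] by (simp add: mod_add_left_eq add.assoc)
    show "(c + (b + q) mod p) mod p = b"
      using b shift[of b] by (simp add: mod_add_right_eq)
  qed (use assms in auto)
qed

text \<open>Subtracting from an index whose digits are all maximal never borrows, so reflection
  complements quotient and remainder separately.\<close>

lemma mirror_digits:
  fixes k b m p :: nat
  assumes "k < m" "b < p"
  shows "m * p - Suc (k * p + b) = (m - Suc k) * p + (p - Suc b)"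
proof -
  obtain m' b' where "m = Suc k + m'" "p = Suc b + b'"
    using assms by (metis less_iff_Suc_add add_Suc)
  then show ?thesis by (simp add: algebra_simps)
qed

lemma mod_mirror:
  assumes "r < m * p"
  shows "(m * p - Suc r) mod p = p - Suc (r mod p)"
proof -
  have p: "0 < p" using assms by (cases p) auto
  moreover have "r div p < m" using assms by (simp add: less_mult_imp_div_less)
  ultimately show ?thesis
    using mirror_digits[of "r div p" m "r mod p" p] by simp
qed

lemma digits3_less:
  fixes p :: nat
  assumes "j < p" "i < p" "a < p"
  shows "(j * p + i) * p + a < p ^ 3"
proof -
  have "j * p + i < p * p"
    using assms mult_le_mono1[of "Suc j" p p] by simp
  then have "Suc (j * p + i) * p \<le> p * p * p"
    using mult_le_mono1 Suc_leI by blast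
  then show ?thesis using assms by (simp add: power3_eq_cube algebra_simps)
qed

section \<open>Column maps of the two families of broken diagonals\<close>

lemma shift_mod_inverse:
  fixes n :: nat
  assumes "d < n" "i < n"
  shows "((d + i) mod n + (n - d)) mod n = i" and "(d + (i + (n - d)) mod n) mod n = i"
proof -
  have "(d + i + (n - d)) mod n = i" "(d + (i + (n - d))) mod n = i" using assms by auto
  then show "((d + i) mod n + (n - d)) mod n = i" and "(d + (i + (n - d)) mod n) mod n = i"
    by (simp_all only: mod_add_left_eq mod_add_right_eq)
qed

lemma reflect_mod_inverse:
  fixes n :: nat
  assumes "d < n" "i < n"
  shows "(d + n - (d + n - i) mod n) mod n = i"
proof -
  have "(d + n - i) mod n = (if i \<le> d then d - i else d + n - i)" if "i < n" for i
    using that assms(1) by (auto simp: mod_if)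
  then show ?thesis using assms by auto
qed

text \<open>Discarding a multiple of \<open>m\<close> from \<open>i\<close> changes
  \<open>d + n - i\<close> by a multiple of \<open>p\<close>. It is applied with
  \<open>m = p\<close> to split arrays and with \<open>m = p\<^sup>2\<close> to the example
  square.\<close>

lemma reflect_mod_residue:
  fixes n :: nat
  assumes "p dvd m" "p dvd n" "i < n"
  shows "(d + n - i) mod n mod p = (d + n - i mod m) mod n mod p"
proof -
  obtain k where m: "m = p * k" using assms(1) by auto
  have "d + n - i mod m = (d + n - i) + i div m * m"
    using assms(3) div_mult_mod_eq[of i m] by linarith
  also have "\<dots> = (d + n - i) + i div m * k * p" using m by simp
  finally have "(d + n - i mod m) mod p = (d + n - i) mod p" by (simp only: mod_mult_self1)
  then show ?thesis using assms(2) by (simp add: mod_mod_cancel)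
qed

subsection \<open>Split arrays\<close>

text \<open>The constants stay abstract so that the same facts hold again for transposed and
  reflected arrays. In \<open>(j * p + i) * p + a\<close> only the middle base-\<open>p\<close>
  digit \<open>i\<close> is summed over. The shared \<open>K\<close> with opposite signs is the
  trace of the complementary property.\<close>

locale split_array =
  fixes p :: nat and y :: "nat \<Rightarrow> nat \<Rightarrow> real" and A B :: "nat \<Rightarrow> nat \<Rightarrow> real"
    and T S :: "nat \<Rightarrow> real" and K :: "nat \<Rightarrow> nat \<Rightarrow> real"
  assumes p_pos: "0 < p"
    and y_split: "\<lbrakk>r < p ^ 3; c < p ^ 3\<rbrakk> \<Longrightarrow> y r c = A r (c mod p) + B (r mod p) c"
    and sum_A_row: "r < p ^ 3 \<Longrightarrow> (\<Sum>b<p. A r b) = T (r mod p)"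
    and sum_B_col: "c < p ^ 3 \<Longrightarrow> (\<Sum>a<p. B a c) = S (c mod p)"
    and sum_A_digit: "\<lbrakk>j < p; a < p; b < p\<rbrakk> \<Longrightarrow> (\<Sum>i<p. A ((j * p + i) * p + a) b) = K a b"
    and sum_B_digit: "\<lbrakk>j < p; a < p; b < p\<rbrakk> \<Longrightarrow> (\<Sum>i<p. B a ((j * p + i) * p + b)) = - K a b"
begin

section \<open>Relations among the constants, and symmetries of the structure\<close>

lemma mod_order [simp]: "x mod p ^ 3 mod p = x mod p"
  by (simp add: mod_mod_cancel power3_eq_cube)

text \<open>Double counting of \<open>A\<close> over the \<open>p\<close> rows with leading digit 0
  and residue \<open>a\<close>: summing down the columns gives \<open>K\<close>, summing along the
  rows gives \<open>T\<close>.\<close>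

lemma p_T: assumes "a < p" shows "(\<Sum>b<p. K a b) = p * T a"
proof -
  have "(\<Sum>b<p. K a b) = (\<Sum>b<p. \<Sum>i<p. A ((0 * p + i) * p + a) b)"
    by (intro sum.cong refl, subst sum_A_digit) (use assms p_pos in auto)
  also have "\<dots> = (\<Sum>i<p. \<Sum>b<p. A ((0 * p + i) * p + a) b)" by (rule sum.swap)
  also have "\<dots> = (\<Sum>i<p. T a)"
    by (intro sum.cong refl, subst sum_A_row) (use assms digits3_less[of 0] p_pos in auto)
  finally show ?thesis by simp
qed

text \<open>\<open>A\<close> and \<open>B\<close> exchange roles, which forces the sign of
  \<open>K\<close> to change. Row statements thereby yield column statements.\<close>

lemma transpose:
  "split_array p (\<lambda>r c. y c r) (\<lambda>r b. B b r) (\<lambda>a c. A c a) S T (\<lambda>a b. - K b a)"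
  by unfold_locales
    (use p_pos y_split sum_A_row sum_B_col sum_A_digit sum_B_digit in \<open>auto simp: add.commute\<close>)

text \<open>Reflection complements every base-\<open>p\<close> digit of the column, so a sum over
  all middle digits is merely traversed backwards, in another group of blocks and at another
  residue.\<close>

lemma flip_columns:
  "split_array p (\<lambda>r c. y r (p ^ 3 - Suc c)) (\<lambda>r b. A r (p - Suc b)) (\<lambda>a c. B a (p ^ 3 - Suc c))
     T (\<lambda>b. S (p - Suc b)) (\<lambda>a b. K a (p - Suc b))"
proof
  have cube: "p\<^sup>2 * p = p ^ 3" by (simp add: power2_eq_square power3_eq_cube)
  show "0 < p" by (rule p_pos)
  show "y r (p ^ 3 - Suc c) = A r (p - Suc (c mod p)) + B (r mod p) (p ^ 3 - Suc c)"
    if "r < p ^ 3" "c < p ^ 3" for r c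
    using that y_split[of r "p ^ 3 - Suc c"] mod_mirror[of c "p\<^sup>2" p] by (simp add: cube)
  show "(\<Sum>b<p. A r (p - Suc b)) = T (r mod p)" if "r < p ^ 3" for r
    using sum_A_row[OF that] by (simp add: sum.nat_diff_reindex)
  show "(\<Sum>a<p. B a (p ^ 3 - Suc c)) = S (p - Suc (c mod p))" if "c < p ^ 3" for c
    using that sum_B_col[of "p ^ 3 - Suc c"] mod_mirror[of c "p\<^sup>2" p] by (simp add: cube)
  show "(\<Sum>i<p. A ((j * p + i) * p + a) (p - Suc b)) = K a (p - Suc b)" if "j < p" "a < p" "b < p" for j a b
    using that by (simp add: sum_A_digit)
  show "(\<Sum>i<p. B a (p ^ 3 - Suc ((j * p + i) * p + b))) = - K a (p - Suc b)"
    if *: "j < p" "a < p" "b < p" for j a b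
  proof -
    have "p ^ 3 - Suc ((j * p + i) * p + b) = ((p - Suc j) * p + (p - Suc i)) * p + (p - Suc b)"
      if "i < p" for i
      using that * mirror_digits[of j p i p] mirror_digits[of "j * p + i" "p\<^sup>2" b p]
        mult_le_mono1[of "Suc j" p p] by (simp add: power2_eq_square power3_eq_cube)
    then have "(\<Sum>i<p. B a (p ^ 3 - Suc ((j * p + i) * p + b)))
        = (\<Sum>i<p. B a (((p - Suc j) * p + (p - Suc i)) * p + (p - Suc b)))"
      by simp
    also have "\<dots> = (\<Sum>i<p. B a (((p - Suc j) * p + i) * p + (p - Suc b)))"
      by (rule sum.nat_diff_reindex)
    finally show ?thesis using * sum_B_digit[of "p - Suc j" a "p - Suc b"] by simp
  qed
qed

text \<open>Column reflection followed by transposition. The new array has at \<open>(r, c)\<close>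
  the value of \<open>y\<close> at the turned position, as needed for summing \<open>y\<close> over
  a turned pattern.\<close>

lemma quarter_turn:
  "\<exists>A' B' T' S' K'. split_array p (\<lambda>r c. y c (p ^ 3 - Suc r)) A' B' T' S' K'"
proof -
  interpret t: split_array p "\<lambda>r c. y r (p ^ 3 - Suc c)" "\<lambda>r b. A r (p - Suc b)"
    "\<lambda>a c. B a (p ^ 3 - Suc c)" T "\<lambda>b. S (p - Suc b)" "\<lambda>a b. K a (p - Suc b)"
    by (rule flip_columns)
  show ?thesis using t.transpose by blast
qed

text \<open>The central cancellation. Every chosen row meets each residue once, so \<open>A\<close>
  contributes \<open>p * T a\<close>. For each residue \<open>b\<close> the blocks exhaust one group
  of \<open>p\<close> consecutive ones, so \<open>B\<close> contributes \<open>- K a b\<close>; by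
  \<open>p_T\<close> the total is 0. The group \<open>J b\<close> may vary with \<open>b\<close>,
  which permits a pattern to split between two arms.\<close>

lemma sum_row_blocks:
  assumes row: "\<And>i. i < p \<Longrightarrow> row i < p ^ 3" "\<And>i. i < p \<Longrightarrow> row i mod p = a"
    and J: "\<And>b. b < p \<Longrightarrow> J b < p"
    and bij: "\<And>b. b < p \<Longrightarrow> bij_betw (col b) {..<p} {J b * p..<J b * p + p}"
  shows "(\<Sum>i<p. \<Sum>b<p. y (row i) (col b i * p + b)) = 0"
proof -
  have a: "a < p" using row(2)[OF p_pos] p_pos by auto
  have bound: "col b i * p + b < p ^ 3" if "b < p" "i < p" for b i
  proof -
    have "col b i \<in> {J b * p..<J b * p + p}" using bij[OF that(1)] that(2) by (auto simp: bij_betw_def)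
    then obtain k where "col b i = J b * p + k" "k < p" by (auto simp: le_iff_add)
    then show ?thesis using digits3_less J that by simp
  qed
  have "(\<Sum>i<p. \<Sum>b<p. y (row i) (col b i * p + b))
      = (\<Sum>i<p. \<Sum>b<p. A (row i) b + B a (col b i * p + b))"
    by (intro sum.cong refl) (simp add: y_split row bound)
  also have "\<dots> = (\<Sum>i<p. \<Sum>b<p. A (row i) b) + (\<Sum>b<p. \<Sum>i<p. B a (col b i * p + b))"
    by (simp add: sum.distrib) (rule sum.swap)
  also have "(\<Sum>i<p. \<Sum>b<p. A (row i) b) = p * T a"
    by (simp add: sum_A_row row)
  also have "(\<Sum>b<p. \<Sum>i<p. B a (col b i * p + b)) = (\<Sum>b<p. - K a b)"
  proof (intro sum.cong refl)
    fix b assume "b \<in> {..<p}"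
    then have b: "b < p" by simp
    have "(\<Sum>i<p. B a (col b i * p + b)) = (\<Sum>k\<in>{J b * p..<J b * p + p}. B a (k * p + b))"
      by (rule sum.reindex_bij_betw[OF bij[OF b]])
    also have "\<dots> = (\<Sum>i<p. B a ((J b * p + i) * p + b))"
      using sum.shift_bounds_nat_ivl[of "\<lambda>k. B a (k * p + b)" 0 "J b * p" p]
      by (simp add: atLeast0LessThan add.commute)
    finally show "(\<Sum>i<p. B a (col b i * p + b)) = - K a b"
      using sum_B_digit[OF J[OF b] a b] by simp
  qed
  finally show ?thesis by (simp add: p_T[OF a] sum_negf)
qed

text \<open>A part of a row is the case of \<open>sum_row_blocks\<close> in which the row is
  constant and all residues use the group \<open>s\<close>.\<close>

lemma row_part:
  assumes "r < p ^ 3" "s < p"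
  shows "(\<Sum>c = s * p\<^sup>2..<(s + 1) * p\<^sup>2. y r c) = 0"
proof -
  have "(\<Sum>c = s * p\<^sup>2..<(s + 1) * p\<^sup>2. y r c) = (\<Sum>c<p * p. y r (s * p\<^sup>2 + c))"
    using sum.shift_bounds_nat_ivl[of "y r" 0 "s * p\<^sup>2" "p\<^sup>2"]
    by (simp add: atLeast0LessThan add.commute power2_eq_square algebra_simps)
  also have "\<dots> = (\<Sum>i<p. \<Sum>b<p. y r ((s * p + i) * p + b))"
    by (simp add: sum_digits power2_eq_square algebra_simps)
  also have "\<dots> = 0"
  proof (rule sum_row_blocks[where J = "\<lambda>_. s" and a = "r mod p"])
    show "bij_betw (\<lambda>i. s * p + i) {..<p} {s * p..<s * p + p}"
      by (rule bij_betw_byWitness[where f' = "\<lambda>k. k - s * p"]) auto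
  qed (use assms in auto)
  finally show ?thesis .
qed

lemma subsquare:
  "(\<Sum>a<p. \<Sum>b<p. y ((r + a) mod p ^ 3) ((c + b) mod p ^ 3)) = 0"
proof -
  interpret t: split_array p "\<lambda>r c. y c r" "\<lambda>r b. B b r" "\<lambda>a c. A c a" S T "\<lambda>a b. - K b a"
    by (rule transpose)
  have "(\<Sum>a<p. \<Sum>b<p. y ((r + a) mod p ^ 3) ((c + b) mod p ^ 3)) =
     (\<Sum>a<p. \<Sum>b<p. A ((r + a) mod p ^ 3) ((c + b) mod p) + B ((r + a) mod p) ((c + b) mod p ^ 3))"
    by (intro sum.cong refl) (simp add: y_split p_pos)
  also have "\<dots> = (\<Sum>a<p. \<Sum>b<p. A ((r + a) mod p ^ 3) ((c + b) mod p))
      + (\<Sum>b<p. \<Sum>a<p. B ((r + a) mod p) ((c + b) mod p ^ 3))"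
    by (simp add: sum.distrib) (rule sum.swap)
  also have "\<dots> = (\<Sum>a<p. T ((r + a) mod p)) + (\<Sum>b<p. S ((c + b) mod p))"
    using sum_shift_mod[OF p_pos, of "A x" for x] sum_shift_mod[OF p_pos, of "\<lambda>a. B a x" for x]
    by (simp add: sum_A_row sum_B_col p_pos)
  also have "\<dots> = (\<Sum>a<p. T a) + (\<Sum>b<p. S b)"
    by (simp only: sum_shift_mod[OF p_pos])
  \<comment> \<open>\<open>p_T\<close> gives only \<open>p * T a\<close>, so the equation is scaled
    by \<open>p\<close>; both terms then become the total of \<open>K\<close>, with opposite
    signs.\<close>
  also have "p * \<dots> = (\<Sum>a<p. p * T a) + (\<Sum>b<p. p * S b)"
    by (simp add: sum_distrib_left algebra_simps)
  also have "\<dots> = (\<Sum>a<p. \<Sum>b<p. K a b) + (\<Sum>b<p. \<Sum>a<p. - K a b)"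
    using p_T t.p_T by simp
  also have "(\<Sum>b<p. \<Sum>a<p. - K a b) = - (\<Sum>a<p. \<Sum>b<p. K a b)"
    by (simp add: sum_negf) (rule sum.swap)
  finally show ?thesis using p_pos by simp
qed

section \<open>Sums along permutations that respect residues\<close>

lemma sum_A_all:
  assumes "a < p" "b < p"
  shows "(\<Sum>k<p\<^sup>2. A (k * p + a) b) = p * K a b"
  using assms by (simp add: power2_eq_square sum_digits sum_A_digit)

lemma sum_A_residue:
  assumes "\<And>a. a < p \<Longrightarrow> \<tau> a < p"
  shows "(\<Sum>r<p ^ 3. A r (\<tau> (r mod p))) = (\<Sum>a<p. p * K a (\<tau> a))"
proof -
  have "p ^ 3 = p\<^sup>2 * p" by (simp add: power2_eq_square power3_eq_cube)
  then have "(\<Sum>r<p ^ 3. A r (\<tau> (r mod p))) = (\<Sum>k<p\<^sup>2. \<Sum>a<p. A (k * p + a) (\<tau> a))"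
    by (simp add: sum_digits)
  also have "\<dots> = (\<Sum>a<p. \<Sum>k<p\<^sup>2. A (k * p + a) (\<tau> a))" by (rule sum.swap)
  finally show ?thesis using assms by (simp add: sum_A_all)
qed

text \<open>\<open>\<sigma>\<close> induces a permutation \<open>\<tau>\<close> of the residues. The
  \<open>A\<close> part gives \<open>p\<close> times the sum of \<open>K a (\<tau> a)\<close>; the
  \<open>B\<close> part, reindexed by the inverse so that its column runs freely, gives the negative
  of the same sum.\<close>

lemma sum_permutation:
  assumes \<sigma>: "\<And>i. i < p ^ 3 \<Longrightarrow> \<sigma> i < p ^ 3 \<and> \<sigma>' (\<sigma> i) = i"
    and \<sigma>': "\<And>j. j < p ^ 3 \<Longrightarrow> \<sigma>' j < p ^ 3 \<and> \<sigma> (\<sigma>' j) = j"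
    and residue: "\<And>i. i < p ^ 3 \<Longrightarrow> \<sigma> i mod p = \<sigma> (i mod p) mod p"
    and residue': "\<And>i. i < p ^ 3 \<Longrightarrow> \<sigma>' i mod p = \<sigma>' (i mod p) mod p"
  shows "(\<Sum>i<p ^ 3. y i (\<sigma> i)) = 0"
proof -
  interpret t: split_array p "\<lambda>r c. y c r" "\<lambda>r b. B b r" "\<lambda>a c. A c a" S T "\<lambda>a b. - K b a"
    by (rule transpose)
  define \<tau> \<tau>' where "\<tau> a = \<sigma> a mod p" and "\<tau>' b = \<sigma>' b mod p" for a b
  have le: "p \<le> p ^ 3" using p_pos by (simp add: self_le_power)
  have lt: "\<tau> a < p" "\<tau>' a < p" for a using p_pos by (auto simp: \<tau>_def \<tau>'_def)
  have inv: "\<tau>' (\<tau> a) = a" "\<tau> (\<tau>' a) = a" if "a < p" for a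
    using that le \<sigma>[of a] \<sigma>'[of a] residue[of "\<sigma>' a"] residue'[of "\<sigma> a"] by (auto simp: \<tau>_def \<tau>'_def)
  have "(\<Sum>i<p ^ 3. y i (\<sigma> i)) = (\<Sum>i<p ^ 3. A i (\<tau> (i mod p)) + B (i mod p) (\<sigma> i))"
    using \<sigma> by (intro sum.cong refl) (simp add: y_split \<tau>_def residue[symmetric])
  also have "\<dots> = (\<Sum>i<p ^ 3. A i (\<tau> (i mod p))) + (\<Sum>i<p ^ 3. B (i mod p) (\<sigma> i))"
    by (rule sum.distrib)
  also have "(\<Sum>i<p ^ 3. B (i mod p) (\<sigma> i)) = (\<Sum>j<p ^ 3. B (\<tau>' (j mod p)) j)"
  proof (rule sum.reindex_bij_witness[of _ \<sigma>' \<sigma>])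
    fix i assume "i \<in> {..<p ^ 3}"
    then show "B (\<tau>' (\<sigma> i mod p)) (\<sigma> i) = B (i mod p) (\<sigma> i)"
      using \<sigma>[of i] residue'[of "\<sigma> i"] by (simp add: \<tau>'_def)
  qed (use \<sigma> \<sigma>' in auto)
  also have "\<dots> = - (\<Sum>b<p. p * K (\<tau>' b) b)"
    using t.sum_A_residue[of \<tau>'] lt by (simp add: sum_negf)
  also have "(\<Sum>b<p. p * K (\<tau>' b) b) = (\<Sum>a<p. p * K a (\<tau> a))"
    by (rule sum.reindex_bij_witness[of _ \<tau> \<tau>']) (use lt inv in auto)
  finally show ?thesis using sum_A_residue[of \<tau>] lt by simp
qed

lemma diagonals:
  assumes "d < p ^ 3"
  shows "(\<Sum>i<p ^ 3. y i ((d + i) mod p ^ 3)) = 0"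
    and "(\<Sum>i<p ^ 3. y i ((d + p ^ 3 - i) mod p ^ 3)) = 0"
proof -
  show "(\<Sum>i<p ^ 3. y i ((d + i) mod p ^ 3)) = 0"
  proof (rule sum_permutation[where \<sigma>' = "\<lambda>i. (i + (p ^ 3 - d)) mod p ^ 3"])
    fix i assume "i < p ^ 3"
    note inverse = shift_mod_inverse[OF assms this]
    show "(d + i) mod p ^ 3 < p ^ 3 \<and> ((d + i) mod p ^ 3 + (p ^ 3 - d)) mod p ^ 3 = i"
      using p_pos inverse(1) by simp
    show "(i + (p ^ 3 - d)) mod p ^ 3 < p ^ 3 \<and> (d + (i + (p ^ 3 - d)) mod p ^ 3) mod p ^ 3 = i"
      using p_pos inverse(2) by simp
  qed (auto simp: mod_add_right_eq mod_add_left_eq)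
  show "(\<Sum>i<p ^ 3. y i ((d + p ^ 3 - i) mod p ^ 3)) = 0"
  proof (rule sum_permutation[where \<sigma>' = "\<lambda>i. (d + p ^ 3 - i) mod p ^ 3"])
    fix i assume i: "i < p ^ 3"
    show "(d + p ^ 3 - i) mod p ^ 3 < p ^ 3 \<and> (d + p ^ 3 - (d + p ^ 3 - i) mod p ^ 3) mod p ^ 3 = i"
      using p_pos reflect_mod_inverse[OF assms i] by simp
    then show "(d + p ^ 3 - i) mod p ^ 3 < p ^ 3 \<and> (d + p ^ 3 - (d + p ^ 3 - i) mod p ^ 3) mod p ^ 3 = i" .
  qed (rule reflect_mod_residue; simp)+
qed

end

subsection \<open>Franklin patterns\<close>

text \<open>The patterns list, for each block, the positions taken from it. Here each position
  \<open>b\<close> instead names its block \<open>col b i\<close>, the form that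
  \<open>sum_row_blocks\<close> expects.\<close>

definition block_row :: "nat \<Rightarrow> nat \<Rightarrow> (nat \<Rightarrow> nat \<Rightarrow> nat) \<Rightarrow> nat \<Rightarrow> nat \<Rightarrow> (nat \<times> nat) set" where
  "block_row p r\<^sub>0 col a i = (\<lambda>b. ((r\<^sub>0 + i * p + a) mod p ^ 3, col b i * p + b)) ` {..<p}"

text \<open>\<open>left\<close> tells whether position \<open>b\<close> lies in the left arm. The
  half that goes left alternates within a pair of rows and again from pair to pair, hence the single
  parity \<open>a + j\<close>; the slant of the arm alternates with \<open>j\<close>.\<close>

definition side_col :: "nat \<Rightarrow> nat \<Rightarrow> nat \<Rightarrow> nat \<Rightarrow> nat \<Rightarrow> nat" where
  "side_col p \<alpha> a b i =
    (let j = a div 2; left = ((b < \<alpha>) = even (a + j));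
         k = (if left = even j then i else p - 1 - i)
     in (if left then j else p - 1 - j) * p + k)"

text \<open>The full bottom row prescribed separately for the tip is the case \<open>i = 0\<close>
  (\<open>c\<close> odd) or \<open>i = p - 1\<close> (\<open>c\<close> even) of the general formula, where left and right arm
  coincide.\<close>

definition middle_col :: "nat \<Rightarrow> nat \<Rightarrow> nat \<Rightarrow> nat \<Rightarrow> nat" where
  "middle_col p \<alpha> b i =
    (let c = (p - 1) div 2; left = ((b < \<alpha>) = even i)
     in if odd c then if left then c * p + c - (i + 1) div 2 else c * p + c + (i + 1) div 2
        else if left then c * p + i div 2 else c * p + (p - 1) - i div 2)"

definition franklin_col :: "nat \<Rightarrow> nat \<Rightarrow> nat \<Rightarrow> nat \<Rightarrow> nat \<Rightarrow> nat" where
  "franklin_col p \<alpha> a = (if odd p \<and> a = p - 1 then middle_col p \<alpha> else side_col p \<alpha> a)"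

text \<open>As \<open>\<alpha> + \<beta> = p\<close>, the pieces in the two arms together use each
  position once.\<close>

lemma cells_Un_eq_block_row:
  assumes "\<alpha> + \<beta> = p"
    and "\<And>b. b < \<alpha> \<Longrightarrow> col b i = j" and "\<And>b. \<lbrakk>\<alpha> \<le> b; b < p\<rbrakk> \<Longrightarrow> col b i = j'"
  shows "cells p r\<^sub>0 i j a {..<\<alpha>} \<union> cells p r\<^sub>0 i j' a {\<alpha>..<\<alpha> + \<beta>} = block_row p r\<^sub>0 col a i"
proof -
  have p: "{..<p} = {..<\<alpha>} \<union> {\<alpha>..<\<alpha> + \<beta>}" using assms(1) by auto
  show ?thesis
    unfolding block_row_def cells_def p image_Un
    by (intro arg_cong2[where f = "(\<union>)"] image_cong) (use assms in auto)
qed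

lemma franklin_sides_eq:
  assumes "\<alpha> + \<beta> = p"
  shows "franklin_sides p r\<^sub>0 \<alpha> \<beta> =
    (\<Union>a\<in>{a. 2 * (a div 2) < p - 1}. \<Union>i<p. block_row p r\<^sub>0 (side_col p \<alpha> a) a i)"
proof -
  let ?R = "\<lambda>a i. block_row p r\<^sub>0 (side_col p \<alpha> a) a i"
  note row = cells_Un_eq_block_row[OF assms, symmetric]
  have "franklin_sides p r\<^sub>0 \<alpha> \<beta> =
    (\<Union>j\<in>{j. 2 * j < p - 1}. \<Union>i\<in>{..<p}. ?R (2 * j) i \<union> ?R (2 * j + 1) i)"
    unfolding franklin_sides_def Let_def
  proof (intro SUP_cong refl)
    fix j i
    show "(if even j then
         cells p r\<^sub>0 i (j * p + i) (2 * j) {..<\<alpha>} \<union>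
         cells p r\<^sub>0 i (j * p + i) (2 * j + 1) {\<alpha>..<\<alpha> + \<beta>} \<union>
         cells p r\<^sub>0 i ((p - 1 - j) * p + (p - 1 - i)) (2 * j) {\<alpha>..<\<alpha> + \<beta>} \<union>
         cells p r\<^sub>0 i ((p - 1 - j) * p + (p - 1 - i)) (2 * j + 1) {..<\<alpha>}
       else
         cells p r\<^sub>0 i (j * p + (p - 1 - i)) (2 * j) {\<alpha>..<\<alpha> + \<beta>} \<union>
         cells p r\<^sub>0 i (j * p + (p - 1 - i)) (2 * j + 1) {..<\<alpha>} \<union>
         cells p r\<^sub>0 i ((p - 1 - j) * p + i) (2 * j) {..<\<alpha>} \<union>
         cells p r\<^sub>0 i ((p - 1 - j) * p + i) (2 * j + 1) {\<alpha>..<\<alpha> + \<beta>})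
       = ?R (2 * j) i \<union> ?R (2 * j + 1) i"
    proof (cases "even j")
      case True
      have "?R (2 * j) i = cells p r\<^sub>0 i (j * p + i) (2 * j) {..<\<alpha>} \<union>
          cells p r\<^sub>0 i ((p - 1 - j) * p + (p - 1 - i)) (2 * j) {\<alpha>..<\<alpha> + \<beta>}"
        by (rule row) (use True in \<open>auto simp: side_col_def Let_def\<close>)
      moreover have "?R (2 * j + 1) i = cells p r\<^sub>0 i ((p - 1 - j) * p + (p - 1 - i)) (2 * j + 1) {..<\<alpha>} \<union>
          cells p r\<^sub>0 i (j * p + i) (2 * j + 1) {\<alpha>..<\<alpha> + \<beta>}"
        by (rule row) (use True in \<open>auto simp: side_col_def Let_def\<close>)
      ultimately show ?thesis using True by auto
    next
      case False
      have "?R (2 * j) i = cells p r\<^sub>0 i ((p - 1 - j) * p + i) (2 * j) {..<\<alpha>} \<union>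
          cells p r\<^sub>0 i (j * p + (p - 1 - i)) (2 * j) {\<alpha>..<\<alpha> + \<beta>}"
        by (rule row) (use False in \<open>auto simp: side_col_def Let_def\<close>)
      moreover have "?R (2 * j + 1) i = cells p r\<^sub>0 i (j * p + (p - 1 - i)) (2 * j + 1) {..<\<alpha>} \<union>
          cells p r\<^sub>0 i ((p - 1 - j) * p + i) (2 * j + 1) {\<alpha>..<\<alpha> + \<beta>}"
        by (rule row) (use False in \<open>auto simp: side_col_def Let_def\<close>)
      ultimately show ?thesis using False by auto
    qed
  qed
  also have "\<dots> = (\<Union>a\<in>{a. 2 * (a div 2) < p - 1}. \<Union>i<p. ?R a i)"
  proof -
    have "{a. 2 * (a div 2) < p - 1} = (\<Union>j\<in>{j. 2 * j < p - 1}. {2 * j, 2 * j + 1})"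
    proof (intro set_eqI iffI)
      fix a assume "a \<in> {a. 2 * (a div 2) < p - 1}"
      moreover have "a = 2 * (a div 2) \<or> a = 2 * (a div 2) + 1" by presburger
      ultimately show "a \<in> (\<Union>j\<in>{j. 2 * j < p - 1}. {2 * j, 2 * j + 1})" by blast
    qed auto
    then show ?thesis by (simp add: UN_Un_distrib)
  qed
  finally show ?thesis .
qed

lemma franklin_middle_eq:
  assumes "\<alpha> + \<beta> = p" "odd p"
  shows "franklin_middle p r\<^sub>0 \<alpha> \<beta> = (\<Union>i<p. block_row p r\<^sub>0 (middle_col p \<alpha>) (p - 1) i)"
proof -
  define c where "c = (p - 1) div 2"
  define R where "R = block_row p r\<^sub>0 (middle_col p \<alpha>) (p - 1)"
  have p: "p = 2 * c + 1" using assms(2) by (auto simp: c_def elim: oddE)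
  note row = cells_Un_eq_block_row[OF assms(1), where col = "middle_col p \<alpha>" and a = "p - 1" and r\<^sub>0 = r\<^sub>0, folded R_def, symmetric]
  define arms where "arms i jL jR =
      (if even i then cells p r\<^sub>0 i jL (p - 1) {..<\<alpha>} \<union> cells p r\<^sub>0 i jR (p - 1) {\<alpha>..<\<alpha> + \<beta>}
       else cells p r\<^sub>0 i jL (p - 1) {\<alpha>..<\<alpha> + \<beta>} \<union> cells p r\<^sub>0 i jR (p - 1) {..<\<alpha>})" for i jL jR
  have whole: "R i = cells p r\<^sub>0 i j (p - 1) {..<p}" if "\<And>b. middle_col p \<alpha> b i = j" for i j
    unfolding R_def block_row_def cells_def by (simp add: that)
  have arms: "R i = arms i jL jR"
    if "\<And>b. middle_col p \<alpha> b i = (if (b < \<alpha>) = even i then jL else jR)" for i jL jR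
  proof (cases "even i")
    case True
    have "R i = cells p r\<^sub>0 i jL (p - 1) {..<\<alpha>} \<union> cells p r\<^sub>0 i jR (p - 1) {\<alpha>..<\<alpha> + \<beta>}"
      by (rule row) (use that True in auto)
    then show ?thesis using True by (simp add: arms_def)
  next
    case False
    have "R i = cells p r\<^sub>0 i jR (p - 1) {..<\<alpha>} \<union> cells p r\<^sub>0 i jL (p - 1) {\<alpha>..<\<alpha> + \<beta>}"
      by (rule row) (use that False in auto)
    then show ?thesis using False by (auto simp: arms_def)
  qed
  have "franklin_middle p r\<^sub>0 \<alpha> \<beta> = (\<Union>i<p. R i)"
  proof (cases "odd c")
    case True
    have "R 0 = cells p r\<^sub>0 0 (c * p + c) (p - 1) {..<p}"
      by (rule whole) (use True in \<open>simp add: middle_col_def[of p, folded c_def] Let_def\<close>)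
    moreover have "R i = arms i (c * p + c - (i + 1) div 2) (c * p + c + (i + 1) div 2)" for i
      by (rule arms) (use True in \<open>simp add: middle_col_def[of p, folded c_def] Let_def\<close>)
    moreover have "{..<p} = insert 0 {1..p - 1}" using p by auto
    ultimately show ?thesis using True
      by (simp add: franklin_middle_def[of p, folded c_def] Let_def arms_def)
  next
    case False
    have p1: "p - Suc 0 = 2 * c" using p by simp
    have top: "cells p r\<^sub>0 (p - 1) (c * p + c) (p - 1) {..<p} = R (p - 1)"
      by (rule whole[symmetric]) (use False p1 in \<open>simp add: middle_col_def[of p, folded c_def] Let_def\<close>)
    have R: "arms i (c * p + i div 2) (c * p + (p - 1) - i div 2) = R i" for i
      by (rule arms[symmetric]) (use False in \<open>simp add: middle_col_def[of p, folded c_def] Let_def\<close>)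
    have "franklin_middle p r\<^sub>0 \<alpha> \<beta> = cells p r\<^sub>0 (p - 1) (c * p + c) (p - 1) {..<p} \<union>
        (\<Union>i<p - 1. arms i (c * p + i div 2) (c * p + (p - 1) - i div 2))"
      using False unfolding franklin_middle_def Let_def arms_def c_def[symmetric] by (simp only: if_False)
    also have "\<dots> = (\<Union>i\<in>insert (p - 1) {..<p - 1}. R i)"
      by (simp only: top R UN_insert)
    also have "insert (p - 1) {..<p - 1} = {..<p}" using p by auto
    finally show ?thesis .
  qed
  then show ?thesis by (simp add: R_def)
qed

text \<open>For even \<open>p\<close> the row pairs \<open>2 * j\<close>, \<open>2 * j + 1\<close>
  exhaust all \<open>a < p\<close>; for odd \<open>p\<close> they leave exactly the bottom row
  \<open>p - 1\<close>, which the middle part supplies.\<close>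

lemma franklin_up_eq:
  assumes "\<alpha> + \<beta> = p" "1 \<le> \<alpha>"
  shows "franklin_up p r\<^sub>0 \<alpha> \<beta> = (\<Union>a<p. \<Union>i<p. block_row p r\<^sub>0 (franklin_col p \<alpha> a) a i)"
proof (cases "odd p")
  case True
  then have p: "{..<p} = insert (p - 1) {a. 2 * (a div 2) < p - 1}"
    by (auto elim!: oddE)
  have "p - 1 \<noteq> a" if "2 * (a div 2) < p - 1" for a
    using that True by presburger
  then have "(\<Union>a\<in>{a. 2 * (a div 2) < p - 1}. \<Union>i<p. block_row p r\<^sub>0 (franklin_col p \<alpha> a) a i)
      = franklin_sides p r\<^sub>0 \<alpha> \<beta>"
    unfolding franklin_sides_eq[OF assms(1)] by (intro SUP_cong refl) (auto simp: franklin_col_def)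
  moreover have "(\<Union>i<p. block_row p r\<^sub>0 (franklin_col p \<alpha> (p - 1)) (p - 1) i)
      = franklin_middle p r\<^sub>0 \<alpha> \<beta>"
    using True by (simp add: franklin_middle_eq[OF assms(1)] franklin_col_def)
  moreover have "(\<Union>a<p. Q a) = Q (p - 1) \<union> (\<Union>a\<in>{a. 2 * (a div 2) < p - 1}. Q a)"
    for Q :: "nat \<Rightarrow> (nat \<times> nat) set"
    unfolding p by simp
  ultimately show ?thesis using True
    by (simp add: franklin_up_def Un_commute)
next
  case False
  then have "a < p \<longleftrightarrow> 2 * (a div 2) < p - 1" for a
    using assms by presburger
  then have "{..<p} = {a. 2 * (a div 2) < p - 1}" by auto
  then show ?thesis using False assms
    by (simp add: franklin_up_def franklin_sides_eq franklin_col_def)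
qed

text \<open>This is the hypothesis on \<open>col\<close> in \<open>sum_row_blocks\<close>. On the
  sides a fixed position stays in one arm and crosses its group monotonically. In the middle it
  alternates between the arms, moving away from the centre (\<open>c\<close> odd) or towards it
  (\<open>c\<close> even), so no block is met twice.\<close>

lemma bij_betw_franklin_col:
  assumes "a < p"
  shows "\<exists>J<p. bij_betw (franklin_col p \<alpha> a b) {..<p} {J * p..<J * p + p}"
proof -
  have bij: "bij_betw (\<lambda>i. J * p + k i) {..<p} {J * p..<J * p + p}"
    if "inj_on k {..<p}" "\<And>i. i < p \<Longrightarrow> k i < p" for J and k :: "nat \<Rightarrow> nat"
  proof -
    have "k ` {..<p} = {..<p}" using that by (intro endo_inj_surj) auto
    then have "bij_betw k {..<p} {..<p}" using that by (simp add: bij_betw_def)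
    moreover have "bij_betw (\<lambda>i. J * p + i) {..<p} {J * p..<J * p + p}"
      by (rule bij_betw_byWitness[where f' = "\<lambda>k. k - J * p"]) auto
    ultimately show ?thesis using bij_betw_trans[of k _ _ "\<lambda>i. J * p + i"] by (simp add: o_def)
  qed
  show ?thesis
  proof (cases "odd p \<and> a = p - 1")
    case True
    define c where "c = (p - 1) div 2"
    have p: "p = 2 * c + 1" using True by (auto simp: c_def elim: oddE)
    define k where "k i =
       (let left = ((b < \<alpha>) = even i)
        in if odd c then if left then c - (i + 1) div 2 else c + (i + 1) div 2
        else if left then i div 2 else p - 1 - i div 2)" for i
    have "inj_on k {..<p}"
    proof (rule inj_onI)
      fix i i' assume lt: "i \<in> {..<p}" "i' \<in> {..<p}" and eq: "k i = k i'"
      \<comment> \<open>Splitting each index into its half and its parity makes all cases of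
        \<open>k\<close> linear.\<close>
      define m m' where "m = i div 2" and "m' = i' div 2"
      then have m: "i = 2 * m \<or> i = 2 * m + 1" "i' = 2 * m' \<or> i' = 2 * m' + 1"
        by presburger+
      show "i = i'"
        using m lt eq by (elim disjE; cases "b < \<alpha>"; cases "odd c") (simp_all add: k_def p)
    qed
    moreover have "k i < p" if "i < p" for i
    proof -
      define m where "m = i div 2"
      then have m: "i = 2 * m \<or> i = 2 * m + 1" by presburger
      show ?thesis using m that by (elim disjE; cases "b < \<alpha>"; cases "odd c") (simp_all add: k_def p)
    qed
    ultimately have "bij_betw (\<lambda>i. c * p + k i) {..<p} {c * p..<c * p + p}" by (rule bij)
    moreover have "franklin_col p \<alpha> a b i = c * p + k i" if "i < p" for i
    proof -
      have "(i + 1) div 2 \<le> c" "i div 2 \<le> p - 1" using that p by auto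
      then show ?thesis using True
        by (auto simp: franklin_col_def middle_col_def[of p, folded c_def] k_def Let_def)
    qed
    ultimately have "bij_betw (franklin_col p \<alpha> a b) {..<p} {c * p..<c * p + p}"
      using bij_betw_cong[of "{..<p}" "franklin_col p \<alpha> a b" "\<lambda>i. c * p + k i"] by simp
    moreover have "c < p" using p by simp
    ultimately show ?thesis by blast
  next
    case False
    define left J where "left \<longleftrightarrow> (b < \<alpha>) = even (a + a div 2)"
      and "J = (if left then a div 2 else p - 1 - a div 2)"
    have "franklin_col p \<alpha> a b =
        (\<lambda>i. J * p + (if left = even (a div 2) then i else p - 1 - i))"
    proof -
      have "franklin_col p \<alpha> a = side_col p \<alpha> a" using False by (simp only: franklin_col_def if_False)
      then show ?thesis by (simp add: fun_eq_iff side_col_def Let_def left_def J_def)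
    qed
    moreover have "bij_betw (\<lambda>i. J * p + (if left = even (a div 2) then i else p - 1 - i)) {..<p} {J * p..<J * p + p}"
      by (rule bij) (auto simp: inj_on_def)
    moreover have "J < p" using assms by (auto simp: J_def)
    ultimately show ?thesis by metis
  qed
qed

section \<open>Coordinates on a Franklin pattern\<close>

definition franklin_cell :: "nat \<Rightarrow> nat \<Rightarrow> nat \<Rightarrow> nat \<times> nat \<times> nat \<Rightarrow> nat \<times> nat" where
  "franklin_cell p r\<^sub>0 \<alpha> = (\<lambda>(a, i, b). ((r\<^sub>0 + i * p + a) mod p ^ 3, franklin_col p \<alpha> a b i * p + b))"

text \<open>The column modulo \<open>p\<close> recovers \<open>b\<close>. The row offset
  \<open>i * p + a\<close> stays below \<open>p ^ 3\<close>, so wraparound identifies no two rows,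
  and its digits recover \<open>i\<close> and \<open>a\<close>.\<close>

lemma bij_betw_franklin_cell:
  assumes "\<alpha> + \<beta> = p" "1 \<le> \<alpha>"
  shows "bij_betw (franklin_cell p r\<^sub>0 \<alpha>) ({..<p} \<times> {..<p} \<times> {..<p}) (franklin_up p r\<^sub>0 \<alpha> \<beta>)"
  unfolding bij_betw_def
proof
  show "inj_on (franklin_cell p r\<^sub>0 \<alpha>) ({..<p} \<times> {..<p} \<times> {..<p})"
  proof (rule inj_onI, clarsimp simp: franklin_cell_def)
    fix a i b a' i' b'
    assume lt: "a < p" "i < p" "b < p" "a' < p" "i' < p" "b' < p"
      and row: "(r\<^sub>0 + i * p + a) mod p ^ 3 = (r\<^sub>0 + i' * p + a') mod p ^ 3"
      and col: "franklin_col p \<alpha> a b i * p + b = franklin_col p \<alpha> a' b' i' * p + b'"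
    have "i * p + a < p ^ 3" "i' * p + a' < p ^ 3"
      using digits3_less[of 0] lt by auto
    moreover have "[r\<^sub>0 + (i * p + a) = r\<^sub>0 + (i' * p + a')] (mod p ^ 3)"
      using row by (simp add: cong_def add.assoc)
    ultimately have "i * p + a = i' * p + a'"
      by (metis cong_add_lcancel_nat cong_less_modulus_unique_nat)
    then have "i = i'" "a = a'"
      using lt by (metis div_mult_self3 div_less add.right_neutral mod_mult_self3 mod_less not_less_zero)+
    moreover have "b = b'" using col lt by (metis mod_mult_self3 mod_less)
    ultimately show "a = a' \<and> i = i' \<and> b = b'" by simp
  qed
  show "franklin_cell p r\<^sub>0 \<alpha> ` ({..<p} \<times> {..<p} \<times> {..<p}) = franklin_up p r\<^sub>0 \<alpha> \<beta>"
    unfolding franklin_up_eq[OF assms] block_row_def franklin_cell_def by force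
qed

lemma (in split_array) sum_franklin_up:
  assumes "\<alpha> + \<beta> = p" "1 \<le> \<alpha>"
  shows "(\<Sum>(r, c)\<in>franklin_up p r\<^sub>0 \<alpha> \<beta>. y r c) = 0"
proof -
  define row where "row a i = (r\<^sub>0 + i * p + a) mod p ^ 3" for a i
  have "(\<Sum>(r, c)\<in>franklin_up p r\<^sub>0 \<alpha> \<beta>. y r c) =
      (\<Sum>x\<in>{..<p} \<times> {..<p} \<times> {..<p}. (\<lambda>(r, c). y r c) (franklin_cell p r\<^sub>0 \<alpha> x))"
    by (rule sum.reindex_bij_betw[OF bij_betw_franklin_cell[OF assms], symmetric])
  also have "\<dots> = (\<Sum>a<p. \<Sum>i<p. \<Sum>b<p. y (row a i) (franklin_col p \<alpha> a b i * p + b))"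
    by (simp add: franklin_cell_def row_def sum.cartesian_product case_prod_unfold)
  also have "\<dots> = (\<Sum>a<p. 0)"
  proof (intro sum.cong refl)
    fix a assume a: "a \<in> {..<p}"
    obtain J where "\<And>b. J b < p \<and> bij_betw (franklin_col p \<alpha> a b) {..<p} {J b * p..<J b * p + p}"
      using bij_betw_franklin_col[of a p \<alpha>] a by (metis lessThan_iff)
    then show "(\<Sum>i<p. \<Sum>b<p. y (row a i) (franklin_col p \<alpha> a b i * p + b)) = 0"
    \<comment> \<open>The start \<open>r\<^sub>0\<close> shifts the row residue, but equally for all
      \<open>i\<close>; wraparound preserves it because \<open>p\<close> divides
      \<open>p ^ 3\<close>.\<close>
    proof (intro sum_row_blocks[where J = J and a = "(r\<^sub>0 + a) mod p"])
      show "row a i mod p = (r\<^sub>0 + a) mod p" for i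
        by (simp add: row_def add.assoc add.left_commute[of r\<^sub>0])
    qed (use p_pos in \<open>auto simp: row_def\<close>)
  qed
  finally show ?thesis by simp
qed

subsection \<open>The image of a most-perfect square under \<open>\<theta>\<close>\<close>

definition deviation :: "nat \<Rightarrow> square \<Rightarrow> nat \<Rightarrow> nat \<Rightarrow> real" where
  "deviation n R r c = real (R r c) - ((real n)\<^sup>2 - 1) / 2"

lemma real_eq_deviation: "real (R r c) = deviation n R r c + ((real n)\<^sup>2 - 1) / 2"
  by (simp add: deviation_def)

definition theta_index :: "nat \<Rightarrow> nat \<Rightarrow> nat" where
  "theta_index p r = digit_swap p (r div p) * p + r mod p"

text \<open>For order \<open>p ^ 3\<close> the blocks have side \<open>p\<close>, so
  \<open>theta\<close> permutes both coordinates by one and the same index map.\<close>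

lemma theta_eq: "0 < p \<Longrightarrow> theta p (p ^ 3) R r c = R (theta_index p r) (theta_index p c)"
  by (simp add: theta_def theta_index_def Let_def power2_eq_square power3_eq_cube)

lemma theta_index_mod [simp]: "theta_index p r mod p = r mod p"
  by (simp add: theta_index_def)

text \<open>After the exchange the middle digit \<open>i\<close> has weight
  \<open>p\<^sup>2\<close>, which is the step length in the complementary property.\<close>

lemma theta_index_digits:
  assumes "i < p" "a < p"
  shows "theta_index p ((j * p + i) * p + a) = i * p\<^sup>2 + (j * p + a)"
proof -
  have "((j * p + i) * p + a) div p = j * p + i" "((j * p + i) * p + a) mod p = a"
    "(j * p + i) div p = j" "(j * p + i) mod p = i"
    using assms by auto
  then have "theta_index p ((j * p + i) * p + a) = (i * p + j) * p + a"
    unfolding theta_index_def digit_swap_def by simp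
  then show ?thesis by (simp add: power2_eq_square algebra_simps)
qed

lemma digits3:
  fixes r p :: nat
  assumes "r < p ^ 3"
  obtains j i a where "r = (j * p + i) * p + a" "j < p" "i < p" "a < p"
proof
  have p: "0 < p" using assms by (cases p) auto
  show "r = (r div p div p * p + r div p mod p) * p + r mod p" by simp
  show "r div p div p < p"
    using assms by (simp add: less_mult_imp_div_less power3_eq_cube)
  show "r div p mod p < p" "r mod p < p" using p by auto
qed

lemma theta_index_less_involution:
  assumes "r < p ^ 3"
  shows "theta_index p r < p ^ 3 \<and> theta_index p (theta_index p r) = r"
proof -
  obtain j i a where r: "r = (j * p + i) * p + a" "j < p" "i < p" "a < p"
    using assms by (rule digits3)
  have "theta_index p ((j * p + i) * p + a) = (i * p + j) * p + a" if "j < p" "i < p" for i j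
    using theta_index_digits[of i p a j] that r(4) by (simp add: power2_eq_square algebra_simps)
  then show ?thesis using r digits3_less[of i p j a] by simp
qed

lemma bij_betw_theta_index: "bij_betw (theta_index p) {..<p ^ 3} {..<p ^ 3}"
  by (rule bij_betw_byWitness[where f' = "theta_index p"]) (use theta_index_less_involution in auto)

lemma natural_square_theta:
  assumes "0 < p" "natural_square (p ^ 3) R"
  shows "natural_square (p ^ 3) (theta p (p ^ 3) R)"
proof -
  have "bij_betw (map_prod (theta_index p) (theta_index p)) ({..<p ^ 3} \<times> {..<p ^ 3}) ({..<p ^ 3} \<times> {..<p ^ 3})"
    by (intro bij_betw_map_prod bij_betw_theta_index)
  moreover have "(\<lambda>(r, c). theta p (p ^ 3) R r c) = (\<lambda>(r, c). R r c) \<circ> map_prod (theta_index p) (theta_index p)"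
    using assms(1) by (auto simp: theta_eq)
  ultimately show ?thesis
    using assms(2) bij_betw_trans unfolding natural_square_def by metis
qed

text \<open>The splitting is derived for \<open>R\<close> itself and then carried through
  \<open>theta_index\<close>, which preserves residues modulo \<open>p\<close>.\<close>

lemma split_array_theta:
  assumes p: "0 < p" and sub: "subsquare_property p (p ^ 3) R" and comp: "complementary_property p (p ^ 3) R"
  shows "\<exists>A B T S K. split_array p (deviation (p ^ 3) (theta p (p ^ 3) R)) A B T S K"
proof -
  define n where "n = p ^ 3"
  have n: "0 < n" "n div p = p\<^sup>2" "p dvd n"
    using p by (simp_all add: n_def power2_eq_square power3_eq_cube)
  \<comment> \<open>The periodic extension removes all case distinctions for wraparound.\<close>
  define X where "X r c = deviation n R (r mod n) (c mod n)" for r c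
  have X_mod: "X (r mod n) c = X r c" "X r (c mod n) = X r c" for r c
    by (simp_all add: X_def)
  have square: "(\<Sum>a<p. \<Sum>b<p. X (r + a) (c + b)) = 0" for r c
  proof -
    have "(\<Sum>a<p. \<Sum>b<p. X (r + a) (c + b)) =
        (\<Sum>a<p. \<Sum>b<p. real (R ((r mod n + a) mod n) ((c mod n + b) mod n)) - ((real n)\<^sup>2 - 1) / 2)"
      by (simp add: X_def deviation_def mod_add_left_eq)
    also have "\<dots> = real (\<Sum>a<p. \<Sum>b<p. R ((r mod n + a) mod n) ((c mod n + b) mod n))
         - (real p)\<^sup>2 * ((real n)\<^sup>2 - 1) / 2"
      by (simp add: sum_subtractf power2_eq_square)
    also have "\<dots> = 0"
      using sub n unfolding subsquare_property_def n_def[symmetric] by simp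
    finally show ?thesis .
  qed
  have comp: "(\<Sum>t<p. X (r + t * p\<^sup>2) (c + t * p\<^sup>2)) = 0" for r c
  proof -
    have "(\<Sum>t<p. X (r + t * p\<^sup>2) (c + t * p\<^sup>2)) =
        (\<Sum>t<p. real (R ((r mod n + t * p\<^sup>2) mod n) ((c mod n + t * p\<^sup>2) mod n)) - ((real n)\<^sup>2 - 1) / 2)"
      by (simp add: X_def deviation_def mod_add_left_eq)
    also have "\<dots> = real (\<Sum>t<p. R ((r mod n + t * p\<^sup>2) mod n) ((c mod n + t * p\<^sup>2) mod n))
         - real p * ((real n)\<^sup>2 - 1) / 2"
      by (simp add: sum_subtractf)
    also have "\<dots> = 0"
      using comp n unfolding complementary_property_def n_def[symmetric] by simp
    finally show ?thesis .
  qed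
  have telescope: "(\<Sum>k<p. g (Suc k)) - (\<Sum>k<p. g k) = g p - g 0" for g :: "nat \<Rightarrow> real"
    using sum_lessThan_telescope[of g p] by (simp add: sum_subtractf)
  \<comment> \<open>Two subsquares one row apart share all but their extreme rows.\<close>
  have row_strip: "(\<Sum>b<p. X (r + p) (c + b)) = (\<Sum>b<p. X r (c + b))" for r c
    using telescope[of "\<lambda>a. \<Sum>b<p. X (r + a) (c + b)"] square[of r c] square[of "Suc r" c] by simp
  have col_strip: "(\<Sum>a<p. X (r + a) (c + p)) = (\<Sum>a<p. X (r + a) c)" for r c
    using telescope[of "\<lambda>b. \<Sum>a<p. X (r + a) (c + b)"] square[of r c] square[of r "Suc c"]
    by (simp add: sum.swap[of "\<lambda>b a. X (r + a) (c + b)"] sum.swap[of "\<lambda>b a. X (r + a) (Suc (c + b))"])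
  \<comment> \<open>Differencing \<open>col_strip\<close> once more, now in the row direction,
    leaves a mixed second difference with step \<open>p\<close> both ways.\<close>
  have cross: "X (r + p) (c + p) - X r (c + p) = X (r + p) c - X r c" for r c
    using telescope[of "\<lambda>a. X (r + a) (c + p)"] telescope[of "\<lambda>a. X (r + a) c"]
      col_strip[of r c] col_strip[of "Suc r" c] by simp
  have cross': "X (r + p) (c + k * p) - X r (c + k * p) = X (r + p) c - X r c" for r c k
  proof (induction k)
    case (Suc k)
    then show ?case using cross[of r "c + k * p"] by (simp add: algebra_simps)
  qed simp
  have cross'': "X (r + l * p) (c + k * p) - X (r + l * p) c = X r (c + k * p) - X r c" for r c k l
  proof (induction l)
    case (Suc l)
    then show ?case using cross'[of "r + l * p" c k] by (simp add: algebra_simps)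
  qed simp
  \<comment> \<open>The vanishing mixed difference on the rectangle spanned by \<open>(r, c)\<close>
    and its pair of residues.\<close>
  have X_split: "X r c = X r (c mod p) + (X (r mod p) c - X (r mod p) (c mod p))" for r c
    using cross''[of "r mod p" "r div p" "c mod p" "c div p"] by simp
  have row_sum: "(\<Sum>b<p. X (r + l * p) b) = (\<Sum>b<p. X r b)" for r l
  proof (induction l)
    case (Suc l)
    then show ?case using row_strip[of "r + l * p" 0] by (simp add: algebra_simps)
  qed simp
  have col_sum: "(\<Sum>a<p. X a (c + l * p)) = (\<Sum>a<p. X a c)" for c l
  proof (induction l)
    case (Suc l)
    then show ?case using col_strip[of 0 "c + l * p"] by (simp add: algebra_simps)
  qed simp
  \<comment> \<open>Steps of \<open>p\<^sup>2\<close> keep both residues, so the complementary sum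
    separates into a part depending on \<open>r\<close> and one depending on \<open>c\<close>. Since
    \<open>r\<close> and \<open>c\<close> vary independently within their residues, each part is
    constant there.\<close>
  have comp_split: "(\<Sum>t<p. X (r + t * p\<^sup>2) b) + (\<Sum>t<p. X a (c + t * p\<^sup>2) - X a b) = 0"
    if "r mod p = a" "c mod p = b" for r c a b
  proof -
    have "(x + t * p\<^sup>2) mod p = x mod p" for x t
      by (simp add: power2_eq_square mult.assoc[symmetric])
    then have "X (r + t * p\<^sup>2) (c + t * p\<^sup>2) = X (r + t * p\<^sup>2) b + (X a (c + t * p\<^sup>2) - X a b)" for t
      using X_split[of "r + t * p\<^sup>2" "c + t * p\<^sup>2"] that by simp
    then show ?thesis using comp[of r c] by (simp add: sum.distrib)
  qed
  let ?\<sigma> = "theta_index p"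
  \<comment> \<open>The corner term of \<open>X_split\<close> is assigned to \<open>B\<close>; by
    \<open>col_sum\<close> this makes every \<open>S\<close> zero.\<close>
  have "split_array p (deviation n (theta p n R)) (\<lambda>r b. X (?\<sigma> r) b)
      (\<lambda>a c. X a (?\<sigma> c) - X a (c mod p)) (\<lambda>a. \<Sum>b<p. X a b) (\<lambda>_. 0) (\<lambda>a b. \<Sum>t<p. X (a + t * p\<^sup>2) b)"
  proof
    show "0 < p" by (rule p)
    show "deviation n (theta p n R) r c = X (?\<sigma> r) (c mod p) + (X (r mod p) (?\<sigma> c) - X (r mod p) (c mod p))"
      if "r < p ^ 3" "c < p ^ 3" for r c
    proof -
      have "deviation n (theta p n R) r c = X (?\<sigma> r) (?\<sigma> c)"
        using theta_index_less_involution[OF that(1)] theta_index_less_involution[OF that(2)]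
        by (simp add: X_def deviation_def theta_eq[OF p, folded n_def] flip: n_def)
      then show ?thesis using X_split[of "?\<sigma> r" "?\<sigma> c"] by simp
    qed
    show "(\<Sum>b<p. X (?\<sigma> r) b) = (\<Sum>b<p. X (r mod p) b)" for r
      using row_sum[of "?\<sigma> r mod p" "?\<sigma> r div p"] unfolding mod_div_mult_eq by simp
    show "(\<Sum>a<p. X a (?\<sigma> c) - X a (c mod p)) = 0" for c
      using col_sum[of "?\<sigma> c mod p" "?\<sigma> c div p"] unfolding mod_div_mult_eq by (simp add: sum_subtractf)
    show "(\<Sum>i<p. X (?\<sigma> ((j * p + i) * p + a)) b) = (\<Sum>t<p. X (a + t * p\<^sup>2) b)"
      if "j < p" "a < p" "b < p" for j a b
    proof -
      have "(\<Sum>i<p. X (?\<sigma> ((j * p + i) * p + a)) b) = (\<Sum>i<p. X ((j * p + a) + i * p\<^sup>2) b)"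
        by (intro sum.cong refl, subst theta_index_digits) (use that in \<open>simp_all add: add.commute\<close>)
      then show ?thesis
        using comp_split[of "j * p + a" a b b] comp_split[of a a b b] that by simp
    qed
    show "(\<Sum>i<p. X a (?\<sigma> ((j * p + i) * p + b)) - X a (((j * p + i) * p + b) mod p))
        = - (\<Sum>t<p. X (a + t * p\<^sup>2) b)" if "j < p" "a < p" "b < p" for j a b
    proof -
      have "(\<Sum>i<p. X a (?\<sigma> ((j * p + i) * p + b)) - X a (((j * p + i) * p + b) mod p))
          = (\<Sum>i<p. X a ((j * p + b) + i * p\<^sup>2) - X a b)"
        by (intro sum.cong refl, subst theta_index_digits) (use that in \<open>simp_all add: add.commute\<close>)
      then show ?thesis
        using comp_split[of a a "j * p + b" b] that by simp
    qed
  qed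
  then show ?thesis unfolding n_def by blast
qed

section \<open>From vanishing deviations to magic sums, and turned patterns\<close>

lemma card_franklin_up:
  assumes "\<alpha> + \<beta> = p" "1 \<le> \<alpha>"
  shows "card (franklin_up p r\<^sub>0 \<alpha> \<beta>) = p ^ 3"
  using bij_betw_same_card[OF bij_betw_franklin_cell[OF assms]]
  by (simp add: card_cartesian_product power3_eq_cube)

text \<open>Every prescribed constant is the mean entry times the number of cells, so it remains
  only to show that deviations cancel.\<close>

lemma sum_real_eq_deviation:
  "(\<Sum>x\<in>I. real (R (f x) (g x)))
    = (\<Sum>x\<in>I. deviation n R (f x) (g x)) + card I * ((real n)\<^sup>2 - 1) / 2"
  by (simp add: real_eq_deviation[of R _ _ n] sum.distrib)

lemma quarter_turn_mono:
  "quarter_turn n ` ({..<n} \<times> {..<n}) \<subseteq> {..<n} \<times> {..<n}"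
  by (auto simp: quarter_turn_def)

lemma inj_on_quarter_turn: "inj_on (quarter_turn n) ({..<n} \<times> {..<n})"
  by (auto simp: inj_on_def quarter_turn_def)

text \<open>Quarter turns are injective only inside the grid, because \<open>n - 1 - r\<close>
  truncates.\<close>

lemma franklin_up_subset:
  assumes "\<alpha> + \<beta> = p" "1 \<le> \<alpha>"
  shows "franklin_up p r\<^sub>0 \<alpha> \<beta> \<subseteq> {..<p ^ 3} \<times> {..<p ^ 3}"
proof -
  have "franklin_cell p r\<^sub>0 \<alpha> (a, i, b) \<in> {..<p ^ 3} \<times> {..<p ^ 3}"
    if lt: "a < p" "i < p" "b < p" for a i b
  proof -
    obtain J where J: "J < p" "bij_betw (franklin_col p \<alpha> a b) {..<p} {J * p..<J * p + p}"
      using bij_betw_franklin_col[OF lt(1)] by blast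
    then have "franklin_col p \<alpha> a b i \<in> {J * p..<J * p + p}"
      using lt by (auto simp: bij_betw_def)
    then obtain k where "franklin_col p \<alpha> a b i = J * p + k" "k < p" by (auto simp: le_iff_add)
    then show ?thesis using digits3_less J(1) lt by (simp add: franklin_cell_def)
  qed
  then have "franklin_cell p r\<^sub>0 \<alpha> ` ({..<p} \<times> {..<p} \<times> {..<p}) \<subseteq> {..<p ^ 3} \<times> {..<p ^ 3}"
    by (intro image_subsetI) (metis prod_cases3 SigmaE2 lessThan_iff)
  then show ?thesis
    using bij_betw_imp_surj_on[OF bij_betw_franklin_cell[OF assms, of r\<^sub>0]] by simp
qed

text \<open>The zero sum is required for all split arrays at once because a quarter turn of the set
  changes the array.\<close>

definition balanced_set :: "nat \<Rightarrow> (nat \<times> nat) set \<Rightarrow> bool" where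
  "balanced_set p W \<longleftrightarrow> W \<subseteq> {..<p ^ 3} \<times> {..<p ^ 3} \<and> card W = p ^ 3 \<and>
    (\<forall>y A B T S K. split_array p y A B T S K \<longrightarrow> (\<Sum>(r, c)\<in>W. y r c) = 0)"

lemma balanced_set_quarter_turn:
  assumes "balanced_set p W"
  shows "balanced_set p (quarter_turn (p ^ 3) ` W)"
proof -
  have W: "W \<subseteq> {..<p ^ 3} \<times> {..<p ^ 3}" "card W = p ^ 3"
    and sum: "\<And>y A B T S K. split_array p y A B T S K \<Longrightarrow> (\<Sum>(r, c)\<in>W. y r c) = 0"
    using assms unfolding balanced_set_def by blast+
  have inj: "inj_on (quarter_turn (p ^ 3)) W"
    by (rule inj_on_subset[OF inj_on_quarter_turn W(1)])
  have "(\<Sum>(r, c)\<in>quarter_turn (p ^ 3) ` W. y r c) = 0" if y: "split_array p y A B T S K" for y A B T S K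
  proof -
    obtain A' B' T' S' K' where "split_array p (\<lambda>r c. y c (p ^ 3 - Suc r)) A' B' T' S' K'"
      using split_array.quarter_turn[OF y] by blast
    then have "(\<Sum>(r, c)\<in>W. y c (p ^ 3 - Suc r)) = 0" by (rule sum)
    then show ?thesis
      by (simp add: sum.reindex[OF inj]) (simp add: quarter_turn_def case_prod_unfold)
  qed
  moreover have "quarter_turn (p ^ 3) ` W \<subseteq> {..<p ^ 3} \<times> {..<p ^ 3}"
    using W(1) quarter_turn_mono by blast
  ultimately show ?thesis
    using W(2) card_image[OF inj] unfolding balanced_set_def by auto
qed

lemma balanced_set_franklin_pattern:
  assumes "P \<in> franklin_patterns p"
  shows "balanced_set p P"
proof -
  obtain k r\<^sub>0 \<alpha> \<beta> where P: "P = (quarter_turn (p ^ 3) ^^ k) ` franklin_up p r\<^sub>0 \<alpha> \<beta>"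
    and sum: "1 \<le> \<alpha>" "\<alpha> + \<beta> = p"
    using assms by (auto simp: franklin_patterns_def)
  have "balanced_set p (franklin_up p r\<^sub>0 \<alpha> \<beta>)"
    unfolding balanced_set_def
  proof (intro conjI allI impI)
    fix y A B T S K assume "split_array p y A B T S K"
    then show "(\<Sum>(r, c)\<in>franklin_up p r\<^sub>0 \<alpha> \<beta>. y r c) = 0"
      using sum by (intro split_array.sum_franklin_up)
  qed (rule franklin_up_subset[OF sum(2,1)] card_franklin_up[OF sum(2,1)])+
  then have "balanced_set p ((quarter_turn (p ^ 3) ^^ k) ` franklin_up p r\<^sub>0 \<alpha> \<beta>)" for k
  proof (induction k)
    case (Suc k)
    have "(quarter_turn (p ^ 3) ^^ Suc k) ` franklin_up p r\<^sub>0 \<alpha> \<beta>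
        = quarter_turn (p ^ 3) ` (quarter_turn (p ^ 3) ^^ k) ` franklin_up p r\<^sub>0 \<alpha> \<beta>"
      by (simp only: funpow.simps image_comp)
    then show ?case using balanced_set_quarter_turn Suc by simp
  qed simp
  then show ?thesis by (simp add: P)
qed

lemma franklin_square_theta:
  assumes p: "0 < p" and R: "most_perfect p (p ^ 3) R"
  shows "franklin_square p (theta p (p ^ 3) R)"
    and "broken_diagonals_magic (p ^ 3) (theta p (p ^ 3) R)"
proof -
  define n Q where "n = p ^ 3" and "Q = theta p n R"
  have n: "n div p = p\<^sup>2" "real n = real p * (real p)\<^sup>2"
    using p by (simp_all add: n_def power2_eq_square power3_eq_cube)
  obtain A B T S K where "split_array p (deviation n Q) A B T S K"
    using split_array_theta[OF p] R unfolding most_perfect_def n_def Q_def by blast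
  then interpret split_array p "deviation n Q" A B T S K .
  interpret t: split_array p "\<lambda>r c. deviation n Q c r" "\<lambda>r b. B b r" "\<lambda>a c. A c a" S T "\<lambda>a b. - K b a"
    by (rule transpose)
  note dev = sum_real_eq_deviation[of Q _ _ _ n]
  show "broken_diagonals_magic (p ^ 3) (theta p (p ^ 3) R)"
    using diagonals unfolding broken_diagonals_magic_def magic_sum_def n_def[symmetric] Q_def[symmetric]
    by (simp add: dev)
  have "natural_square n Q"
    using natural_square_theta[OF p] R by (simp add: most_perfect_def n_def Q_def)
  moreover have "subsquare_property p n Q"
    unfolding subsquare_property_def
  proof (intro allI impI)
    fix r c
    have "(\<Sum>a<p. \<Sum>b<p. deviation n Q ((r + a) mod n) ((c + b) mod n)) = 0"
      using subsquare by (simp add: n_def)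
    then show "real (\<Sum>a<p. \<Sum>b<p. Q ((r + a) mod n) ((c + b) mod n)) = (real p)\<^sup>2 * ((real n)\<^sup>2 - 1) / 2"
      by (simp add: dev sum.distrib power2_eq_square)
  qed
  moreover have "real n * x / (2 * real p) = (real p)\<^sup>2 * x / 2" for x
    using p by (simp add: n(2))
  then have "row_part_property p n Q" "column_part_property p n Q"
    using row_part t.row_part unfolding row_part_property_def column_part_property_def n(1) n_def[symmetric]
    by (simp_all add: dev)
  moreover have "real (\<Sum>(r, c)\<in>P. Q r c) = magic_sum n" if "P \<in> franklin_patterns p" for P
  proof -
    have "(\<Sum>(r, c)\<in>P. deviation n Q r c) = 0" "card P = n"
      using balanced_set_franklin_pattern[OF that] split_array_axioms
      unfolding balanced_set_def n_def by blast+
    then show ?thesis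
      using dev[of fst snd P] by (simp add: case_prod_unfold magic_sum_def)
  qed
  ultimately show "franklin_square p (theta p (p ^ 3) R)"
    unfolding franklin_square_def Let_def n_def[symmetric] Q_def[symmetric] by blast
qed

subsection \<open>Existence of most-perfect squares\<close>

text \<open>Each of the three digits contains the leading digit \<open>r div p\<^sup>2\<close> of \<open>r\<close>, so that it runs
  through all residues along \<open>r + t * p\<^sup>2\<close>, and each contains \<open>c\<close>, so that it runs through all
  residues along \<open>p\<close> consecutive columns. It depends on \<open>c\<close> only modulo \<open>p\<close>.\<close>

definition low_digit :: "nat \<Rightarrow> nat \<Rightarrow> nat \<Rightarrow> nat" where
  "low_digit p r c = (r div p\<^sup>2 + c) mod p"

definition mid_digit :: "nat \<Rightarrow> nat \<Rightarrow> nat \<Rightarrow> nat" where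
  "mid_digit p r c = (r div p\<^sup>2 + r div p + c) mod p"

definition high_digit :: "nat \<Rightarrow> nat \<Rightarrow> nat \<Rightarrow> nat" where
  "high_digit p r c = (r div p\<^sup>2 + r + c) mod p"

definition half_square :: "nat \<Rightarrow> square" where
  "half_square p r c = (high_digit p r c * p + mid_digit p r c) * p + low_digit p r c"

text \<open>As in the superposition of orthogonal squares, a half square and its transpose supply
  the two base-\<open>p ^ 3\<close> digits; row and column conditions then reduce to sums over one
  half square.\<close>

definition example_square :: "nat \<Rightarrow> square" where
  "example_square p r c = half_square p c r * p ^ 3 + half_square p r c"

lemma half_square_less: "0 < p \<Longrightarrow> half_square p r c < p ^ 3"
  unfolding half_square_def by (intro digits3_less) (simp_all add: low_digit_def mid_digit_def high_digit_def)

lemma half_square_eqD: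
  assumes "0 < p" "half_square p r c = half_square p r' c'"
  shows "low_digit p r c = low_digit p r' c'" "mid_digit p r c = mid_digit p r' c'" "high_digit p r c = high_digit p r' c'"
proof -
  have d: "low_digit p r c < p" "mid_digit p r c < p" "high_digit p r c < p" for r c
    using assms(1) by (simp_all add: low_digit_def mid_digit_def high_digit_def)
  have eq: "x = x' \<and> a = a'" if "x * p + a = x' * p + a'" "a < p" "a' < p" for x x' a a'
    using that by (metis add.right_neutral div_less div_mult_self3 mod_less mod_mult_self3 not_less_zero)
  show "low_digit p r c = low_digit p r' c'" "mid_digit p r c = mid_digit p r' c'" "high_digit p r c = high_digit p r' c'"
    using eq[OF assms(2)[unfolded half_square_def]] eq[of "high_digit p r c" "mid_digit p r c" "high_digit p r' c'" "mid_digit p r' c'"] d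
    by auto
qed

text \<open>An entry determines all digits of both half squares. Comparing \<open>high_digit\<close>
  with \<open>low_digit\<close> yields the residue of \<open>r\<close>, and the transposed half that
  of \<open>c\<close>. Then \<open>low_digit\<close> yields the leading digit of \<open>r\<close>
  and \<open>mid_digit\<close> the middle one; likewise for \<open>c\<close>. Counting gives
  surjectivity.\<close>

lemma natural_square_example:
  assumes p: "0 < p"
  shows "natural_square (p ^ 3) (example_square p)"
proof -
  have lt: "example_square p r c < (p ^ 3)\<^sup>2" for r c
  proof -
    have "Suc (half_square p c r) * p ^ 3 \<le> p ^ 3 * p ^ 3"
      using half_square_less[OF p] by (intro mult_le_mono1) (simp add: Suc_leI)
    then show ?thesis
      using half_square_less[OF p, of r c] by (simp add: example_square_def power2_eq_square)
  qed
  have "inj_on (\<lambda>(r, c). example_square p r c) ({..<p ^ 3} \<times> {..<p ^ 3})"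
  proof (rule inj_onI, clarsimp)
    fix r c r' c' assume bound: "r < p ^ 3" "c < p ^ 3" "r' < p ^ 3" "c' < p ^ 3"
      and eq: "example_square p r c = example_square p r' c'"
    have "half_square p r c = half_square p r' c'" "half_square p c r = half_square p c' r'"
      using eq half_square_less[OF p] unfolding example_square_def
      by (metis mod_mult_self3 mod_less)
        (metis add.right_neutral div_less div_mult_self3 eq example_square_def half_square_less not_less_zero p)
    note eqs = half_square_eqD[OF p this(1)] half_square_eqD[OF p this(2)]
    have index_eq: "r = r'"
      if "[r = r'] (mod p)" "[c = c'] (mod p)" "r < p ^ 3" "r' < p ^ 3"
        "low_digit p r c = low_digit p r' c'" "mid_digit p r c = mid_digit p r' c'" for r c r' c'
    proof -
      have high: "[r div p\<^sup>2 = r' div p\<^sup>2] (mod p)"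
        using that(2,5) unfolding low_digit_def cong_def[symmetric]
        by (meson cong_add_rcancel_nat cong_add cong_refl cong_sym cong_trans)
      then have "[r div p = r' div p] (mod p)"
        using that(2,6) unfolding mid_digit_def cong_def[symmetric]
        by (meson cong_add_lcancel_nat cong_add_rcancel_nat cong_add cong_refl cong_sym cong_trans)
      moreover have "x div p\<^sup>2 < p" if "x < p ^ 3" for x
        using that by (intro less_mult_imp_div_less) (simp add: power2_eq_square power3_eq_cube)
      then have "r div p div p = r' div p div p"
        using high that(3,4) by (simp add: cong_def div_mult2_eq[symmetric] power2_eq_square[symmetric])
      ultimately have "r div p = r' div p"
        by (metis cong_def div_mult_mod_eq)
      then show "r = r'" using that(1) by (metis cong_def div_mult_mod_eq)
    qed
    have low: "[r = r'] (mod p)" if "low_digit p r c = low_digit p r' c'" "high_digit p r c = high_digit p r' c'" for r c r' c'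
    proof -
      have "[(r div p\<^sup>2 + c) + r = (r' div p\<^sup>2 + c') + r'] (mod p)"
        using that(2) by (simp add: high_digit_def cong_def ac_simps)
      moreover have "[r div p\<^sup>2 + c = r' div p\<^sup>2 + c'] (mod p)"
        using that(1) by (simp add: low_digit_def cong_def)
      ultimately show ?thesis
        by (meson cong_add_lcancel_nat cong_add cong_refl cong_sym cong_trans)
    qed
    have "[r = r'] (mod p)" "[c = c'] (mod p)" using low eqs by blast+
    then show "r = r' \<and> c = c'" using index_eq eqs bound by blast
  qed
  moreover have "(\<lambda>(r, c). example_square p r c) ` ({..<p ^ 3} \<times> {..<p ^ 3}) \<subseteq> {..<(p ^ 3)\<^sup>2}"
    using lt by auto
  ultimately show ?thesis
    unfolding natural_square_def bij_betw_def
    by (intro conjI card_subset_eq) (auto simp: card_image card_cartesian_product power2_eq_square)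
qed

section \<open>Line sums of the half square\<close>

definition half_deviation :: "nat \<Rightarrow> nat \<Rightarrow> nat \<Rightarrow> real" where
  "half_deviation p r c = real (half_square p r c) - (real p ^ 3 - 1) / 2"

lemma deviation_example:
  "deviation (p ^ 3) (example_square p) r c = half_deviation p c r * real p ^ 3 + half_deviation p r c"
  by (simp add: deviation_def half_deviation_def example_square_def field_simps power2_eq_square)

text \<open>Reducing \<open>r\<close> modulo \<open>p ^ 3\<close> changes \<open>r\<close>,
  \<open>r div p\<close> and \<open>r div p\<^sup>2\<close> only by multiples of
  \<open>p\<close>.\<close>

lemma half_deviation_mod_row: "half_deviation p (r mod p ^ 3) c = half_deviation p r c"
proof -
  have div: "r mod (m * q) div m = r div m mod q" for m q :: nat
    by (cases "m = 0") (simp_all add: mod_mult2_eq)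
  have cube: "p ^ 3 = p\<^sup>2 * p" "p ^ 3 = p * p\<^sup>2" by (simp_all add: power2_eq_square power3_eq_cube)
  have *: "r mod p ^ 3 div p\<^sup>2 = r div p\<^sup>2 mod p" "r mod p ^ 3 div p = r div p mod p\<^sup>2"
    using div[of "p\<^sup>2" p] div[of p "p\<^sup>2"] unfolding cube[symmetric] .
  have **: "r div p mod p\<^sup>2 mod p = r div p mod p" "r mod p ^ 3 mod p = r mod p"
    by (simp_all add: mod_mod_cancel power2_eq_square power3_eq_cube)
  have congs: "[r mod p ^ 3 div p\<^sup>2 = r div p\<^sup>2] (mod p)" "[r mod p ^ 3 div p = r div p] (mod p)"
    "[r mod p ^ 3 = r] (mod p)"
    by (simp_all add: cong_def * **)
  have "low_digit p (r mod p ^ 3) c = low_digit p r c" "mid_digit p (r mod p ^ 3) c = mid_digit p r c"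
    "high_digit p (r mod p ^ 3) c = high_digit p r c"
    unfolding low_digit_def mid_digit_def high_digit_def cong_def[symmetric]
    by (intro cong_add congs cong_refl)+
  then show ?thesis by (simp add: half_deviation_def half_square_def)
qed

lemma half_deviation_mod_col: "half_deviation p r (c mod p) = half_deviation p r c"
  by (simp add: half_deviation_def half_square_def low_digit_def mid_digit_def high_digit_def mod_add_right_eq)

lemma half_deviation_cong_col:
  "c mod p = c' mod p \<Longrightarrow> half_deviation p r c = half_deviation p r c'"
  by (metis half_deviation_mod_col)

text \<open>Each digit runs once through all residues, so its offset is irrelevant and it
  contributes \<open>p * (p - 1) / 2\<close> times its weight. The mean cancels this by
  \<open>(p - 1) * (p\<^sup>2 + p + 1) = p ^ 3 - 1\<close>.\<close>

lemma sum_half_deviation: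
  assumes p: "0 < p" and digits: "\<And>k. k < p \<Longrightarrow> low_digit p (f k) (g k) = (u + k) mod p"
    "\<And>k. k < p \<Longrightarrow> mid_digit p (f k) (g k) = (v + k) mod p"
    "\<And>k. k < p \<Longrightarrow> high_digit p (f k) (g k) = (w + k) mod p"
  shows "(\<Sum>k<p. half_deviation p (f k) (g k)) = 0"
proof -
  define s where "s = (\<Sum>k<p. real k)"
  have digit_sum: "(\<Sum>k<p. real ((x + k) mod p)) = s" for x
    unfolding s_def by (rule sum_shift_mod[OF p])
  have s: "2 * s = real p * (real p - 1)"
    unfolding s_def by (induction p) (auto simp: algebra_simps)
  have "(\<Sum>k<p. half_deviation p (f k) (g k)) = (\<Sum>k<p. real ((w + k) mod p)) * (real p)\<^sup>2
     + (\<Sum>k<p. real ((v + k) mod p)) * real p + (\<Sum>k<p. real ((u + k) mod p)) - real p * (real p ^ 3 - 1) / 2"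
    by (simp add: half_deviation_def half_square_def digits sum.distrib sum_subtractf sum_distrib_left sum_distrib_right
        power2_eq_square algebra_simps)
  also have "\<dots> = s * ((real p)\<^sup>2 + real p + 1) - real p * (real p ^ 3 - 1) / 2"
    unfolding digit_sum by (simp add: algebra_simps)
  also have "2 * \<dots> = 2 * s * ((real p)\<^sup>2 + real p + 1) - real p * (real p ^ 3 - 1)"
    by (simp add: field_simps)
  also have "\<dots> = 0" unfolding s by (simp add: algebra_simps power2_eq_square power3_eq_cube)
  finally show ?thesis by simp
qed

lemma sum_half_deviation_row: "0 < p \<Longrightarrow> (\<Sum>b<p. half_deviation p r (c + b)) = 0"
  by (rule sum_half_deviation[of p _ _ "r div p\<^sup>2 + c" "r div p\<^sup>2 + r div p + c" "r div p\<^sup>2 + r + c"])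
    (simp_all add: low_digit_def mid_digit_def high_digit_def ac_simps)

text \<open>Adding \<open>t * p\<^sup>2\<close> raises the leading digit by \<open>t\<close>, while
  \<open>r div p\<close> and \<open>r\<close> change by multiples of \<open>p\<close>; hence all
  three digits advance by \<open>t\<close>.\<close>

lemma sum_half_deviation_col:
  assumes "0 < p"
  shows "(\<Sum>t<p. half_deviation p (r + t * p\<^sup>2) c) = 0"
proof (rule sum_half_deviation[of p _ _ "r div p\<^sup>2 + c" "r div p\<^sup>2 + r div p + c" "r div p\<^sup>2 + r + c"])
  fix t
  have d: "(r + t * p\<^sup>2) div p\<^sup>2 = r div p\<^sup>2 + t"
    using assms by simp
  have d': "(r + t * p\<^sup>2) div p = r div p + t * p"
    using assms div_mult_self1[of p r "t * p"] by (simp_all add: power2_eq_square mult.assoc)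
  show "low_digit p (r + t * p\<^sup>2) c = (r div p\<^sup>2 + c + t) mod p"
    unfolding low_digit_def d by (simp add: ac_simps)
  have "r div p\<^sup>2 + t + (r div p + t * p) + c = r div p\<^sup>2 + r div p + c + t + t * p" by simp
  then show "mid_digit p (r + t * p\<^sup>2) c = (r div p\<^sup>2 + r div p + c + t) mod p"
    unfolding mid_digit_def d d' by (simp only: mod_mult_self1)
  have "r div p\<^sup>2 + t + (r + t * p\<^sup>2) + c = r div p\<^sup>2 + r + c + t + t * p * p" by (simp add: power2_eq_square)
  then show "high_digit p (r + t * p\<^sup>2) c = (r div p\<^sup>2 + r + c + t) mod p"
    unfolding high_digit_def d by (simp only: mod_mult_self1)
qed (rule assms)

text \<open>The rows are grouped into progressions of step \<open>p\<^sup>2\<close>. Along each of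
  them \<open>g\<close> is constant modulo \<open>p\<close>, so the cells act like cells of a single
  column. This serves columns and both kinds of broken diagonals.\<close>

lemma sum_half_deviation_residue:
  assumes p: "0 < p" and g: "\<And>i. i < p ^ 3 \<Longrightarrow> g i mod p = g (i mod p\<^sup>2) mod p"
  shows "(\<Sum>i<p ^ 3. half_deviation p i (g i)) = 0"
proof -
  have "(\<Sum>i<p ^ 3. half_deviation p i (g i)) = (\<Sum>i<p * p\<^sup>2. half_deviation p i (g i))"
    by (simp add: power2_eq_square power3_eq_cube mult.assoc)
  also have "\<dots> = (\<Sum>t<p. \<Sum>k<p\<^sup>2. half_deviation p (t * p\<^sup>2 + k) (g (t * p\<^sup>2 + k)))"
    by (rule sum_digits)
  also have "\<dots> = (\<Sum>t<p. \<Sum>k<p\<^sup>2. half_deviation p (k + t * p\<^sup>2) (g k))"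
  proof (intro sum.cong refl)
    fix t k assume "t \<in> {..<p}" "k \<in> {..<p\<^sup>2}"
    then have "Suc t * p\<^sup>2 \<le> p * p\<^sup>2" "k < p\<^sup>2" using mult_le_mono1[of "Suc t" p "p\<^sup>2"] by auto
    then have "t * p\<^sup>2 + k < p ^ 3" by (simp add: power2_eq_square power3_eq_cube)
    then show "half_deviation p (t * p\<^sup>2 + k) (g (t * p\<^sup>2 + k)) = half_deviation p (k + t * p\<^sup>2) (g k)"
      using g[of "t * p\<^sup>2 + k"] \<open>k < p\<^sup>2\<close>
      by (subst half_deviation_cong_col[of "g (t * p\<^sup>2 + k)" p "g k"]) (simp_all add: add.commute)
  qed
  also have "\<dots> = (\<Sum>k<p\<^sup>2. \<Sum>t<p. half_deviation p (k + t * p\<^sup>2) (g k))" by (rule sum.swap)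
  finally show ?thesis using sum_half_deviation_col[OF p] by simp
qed

lemma most_perfect_example:
  assumes p: "0 < p"
  shows "most_perfect p (p ^ 3) (example_square p)"
proof -
  define n where "n = p ^ 3"
  have n: "n div p = p\<^sup>2" "p dvd n" "0 < n"
    using p by (simp_all add: n_def power2_eq_square power3_eq_cube)
  let ?h = "half_deviation p" and ?R = "example_square p"
  note dev = sum_real_eq_deviation[of ?R _ _ _ n] and ex = deviation_example[of p, folded n_def]
  have h_mod: "?h (r mod n) (c mod n) = ?h r c" for r c
    using half_deviation_mod_row[of p r] half_deviation_cong_col[of "c mod n" p c] n(2)
    by (simp add: n_def mod_mod_cancel)
  have residue_sum: "(\<Sum>i<n. ?h i (g i)) = 0"
    if "\<And>i. i < n \<Longrightarrow> g i mod p = g (i mod p\<^sup>2) mod p" for g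
    using sum_half_deviation_residue[OF p] that by (simp add: n_def)
  have column: "(\<Sum>i<n. ?h i c) = 0" for c
    by (rule residue_sum) simp
  have row: "(\<Sum>i<n. ?h r i) = 0" for r
  proof -
    have "(\<Sum>i<n. ?h r i) = (\<Sum>i<p\<^sup>2 * p. ?h r i)"
      by (simp add: n_def power2_eq_square power3_eq_cube)
    then show ?thesis by (simp add: sum_digits sum_half_deviation_row[OF p])
  qed
  \<comment> \<open>The transposed half is reindexed by \<open>\<sigma>'\<close>, so that its first
    argument runs freely and \<open>residue_sum\<close> applies to both halves.\<close>
  have permutation: "(\<Sum>i<n. deviation n ?R i (\<sigma> i)) = 0"
    if \<sigma>: "\<And>i. i < n \<Longrightarrow> \<sigma> i < n \<and> \<sigma>' (\<sigma> i) = i" "\<And>i. i < n \<Longrightarrow> \<sigma>' i < n \<and> \<sigma> (\<sigma>' i) = i"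
      and residue: "\<And>i. i < n \<Longrightarrow> \<sigma> i mod p = \<sigma> (i mod p\<^sup>2) mod p"
        "\<And>i. i < n \<Longrightarrow> \<sigma>' i mod p = \<sigma>' (i mod p\<^sup>2) mod p" for \<sigma> \<sigma>'
  proof -
    have "(\<Sum>i<n. ?h (\<sigma> i) i) = (\<Sum>j<n. ?h j (\<sigma>' j))"
      by (rule sum.reindex_bij_witness[of _ \<sigma>' \<sigma>]) (use \<sigma> in auto)
    then show ?thesis
      using residue_sum[of \<sigma>] residue_sum[of \<sigma>'] residue
      by (simp add: ex sum.distrib sum_distrib_right[symmetric])
  qed
  have p2: "p dvd p\<^sup>2" by (simp add: power2_eq_square)
  have "pandiagonal_magic n ?R"
    unfolding pandiagonal_magic_def broken_diagonals_magic_def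
  proof (intro conjI allI impI)
    fix r show "real (\<Sum>c<n. ?R r c) = magic_sum n"
      by (simp add: dev ex sum.distrib sum_distrib_right[symmetric] row column magic_sum_def)
  next
    fix c show "real (\<Sum>r<n. ?R r c) = magic_sum n"
      by (simp add: dev ex sum.distrib sum_distrib_right[symmetric] row column magic_sum_def)
  next
    fix d assume d: "d < n"
    have "(\<Sum>i<n. deviation n ?R i ((d + i) mod n)) = 0"
    proof (rule permutation[where \<sigma>' = "\<lambda>i. (i + (n - d)) mod n"])
      fix i assume "i < n"
      note inverse = shift_mod_inverse[OF d this]
      show "(d + i) mod n < n \<and> ((d + i) mod n + (n - d)) mod n = i"
        using n inverse(1) by simp
      show "(i + (n - d)) mod n < n \<and> (d + (i + (n - d)) mod n) mod n = i"
        using n inverse(2) by simp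
      show "(d + i) mod n mod p = (d + i mod p\<^sup>2) mod n mod p"
        using n(2) p2 by (metis mod_add_right_eq mod_mod_cancel)
      show "(i + (n - d)) mod n mod p = (i mod p\<^sup>2 + (n - d)) mod n mod p"
        using n(2) p2 by (metis mod_add_left_eq mod_mod_cancel)
    qed
    then show "real (\<Sum>i<n. ?R i ((d + i) mod n)) = magic_sum n"
      by (simp add: dev magic_sum_def)
  next
    fix d assume d: "d < n"
    have "(\<Sum>i<n. deviation n ?R i ((d + n - i) mod n)) = 0"
    proof (rule permutation[where \<sigma>' = "\<lambda>i. (d + n - i) mod n"])
      fix i assume i: "i < n"
      show "(d + n - i) mod n < n \<and> (d + n - (d + n - i) mod n) mod n = i"
        using n reflect_mod_inverse[OF d i] by simp
      then show "(d + n - i) mod n < n \<and> (d + n - (d + n - i) mod n) mod n = i" .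
    qed (rule reflect_mod_residue[OF p2 n(2)], assumption)+
    then show "real (\<Sum>i<n. ?R i ((d + n - i) mod n)) = magic_sum n"
      by (simp add: dev magic_sum_def)
  qed
  moreover have "subsquare_property p n ?R"
    unfolding subsquare_property_def
  proof (intro allI impI)
    fix r c
    have "(\<Sum>a<p. \<Sum>b<p. deviation n ?R ((r + a) mod n) ((c + b) mod n))
        = (\<Sum>a<p. \<Sum>b<p. ?h (c + b) (r + a)) * real p ^ 3 + (\<Sum>a<p. \<Sum>b<p. ?h (r + a) (c + b))"
      by (simp add: ex h_mod sum.distrib sum_distrib_right)
    \<comment> \<open>The swap makes the second argument of \<open>?h\<close> the inner one, where
      consecutive values sum to zero.\<close>
    also have "(\<Sum>a<p. \<Sum>b<p. ?h (c + b) (r + a)) = (\<Sum>b<p. \<Sum>a<p. ?h (c + b) (r + a))"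
      by (rule sum.swap)
    finally have "(\<Sum>a<p. \<Sum>b<p. deviation n ?R ((r + a) mod n) ((c + b) mod n)) = 0"
      by (simp add: sum_half_deviation_row[OF p])
    then show "real (\<Sum>a<p. \<Sum>b<p. ?R ((r + a) mod n) ((c + b) mod n)) = (real p)\<^sup>2 * ((real n)\<^sup>2 - 1) / 2"
      by (simp add: dev sum.distrib power2_eq_square)
  qed
  moreover have "complementary_property p n ?R"
    unfolding complementary_property_def n(1)
  proof (intro allI impI)
    fix r c
    have "(\<Sum>t<p. ?h ((r + t * p\<^sup>2) mod n) ((c + t * p\<^sup>2) mod n)) = 0" for r c
    proof -
      \<comment> \<open>A half square sees its column only modulo \<open>p\<close>, so the diagonal
        step acts as a vertical one.\<close>
      have "(c + t * p\<^sup>2) mod p = c mod p" for t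
        by (simp add: power2_eq_square mult.assoc[symmetric])
      then have "?h ((r + t * p\<^sup>2) mod n) ((c + t * p\<^sup>2) mod n) = ?h (r + t * p\<^sup>2) c" for t
        unfolding h_mod by (rule half_deviation_cong_col)
      then show ?thesis using sum_half_deviation_col[OF p] by simp
    qed
    then have "(\<Sum>t<p. deviation n ?R ((r + t * p\<^sup>2) mod n) ((c + t * p\<^sup>2) mod n)) = 0"
      by (simp add: ex sum.distrib sum_distrib_right[symmetric])
    then show "real (\<Sum>t<p. ?R ((r + t * p\<^sup>2) mod n) ((c + t * p\<^sup>2) mod n)) = real p * ((real n)\<^sup>2 - 1) / 2"
      by (simp add: dev)
  qed
  ultimately show ?thesis
    using natural_square_example[OF p] n(2) unfolding most_perfect_def n_def by blast
qed

theorem theorem4p3: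
  fixes p n :: nat
  assumes "prime p" and "n = p ^ 3"
  shows "(\<forall>R. most_perfect p n R \<longrightarrow>
            franklin_square p (theta p n R) \<and> broken_diagonals_magic n (theta p n R)) \<and>
         (\<exists>R. most_perfect p n R)"
proof -
  have "0 < p" using assms(1) by (rule prime_gt_0_nat)
  then show ?thesis
    using franklin_square_theta most_perfect_example unfolding assms(2) by blast
qed

end
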